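(* Let $\mathsf{X}$ be a category with a topological functor $|\text{-}|\colon\mathsf{X}\to\mathsf{Set}$, and let $\mathbf{1}=L\{*\}$, where $L\colon\mathsf{Set}\to\mathsf{X}$ is the left adjoint of $|\text{-}|$. Assume: (a) $\mathsf{X}$ is pre-order enriched; (b) for all objects $X,Y$ of $\mathsf{X}$, all morphisms $x,x'\colon\mathbf{1}\to X$ and every $|\text{-}|$-initial morphism $f\colon X\to Y$, if $f\cdot x\simeq f\cdot x'$ then $x\simeq x'$; (c) $\mathsf{X}$ has enough injectives: for each object $X$ of $\mathsf{X}$ there is a $|\text{-}|$-initial morphism $y_X\colon X\to\hat X$ with $\hat X$ injective, and if $X$ is separated then so is $\hat X$. Then the categories $\mathsf{X}\text{-}\mathsf{Equ}_{\mathrm{sep}}$ and $\mathsf{X}\text{-}\mathsf{PEqu}_{\mathrm{sep}}$ are equivalent.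
   Context: A functor $|\text{-}|\colon\mathsf{X}\to\mathsf{Set}$ is topological if every (possibly large) $|\text{-}|$-structured source $(A\to|X_i|)_i$ has a unique $|\text{-}|$-initial lifting (in particular it is faithful). A morphism $f\colon X\to Y$ is $|\text{-}|$-initial if for every object $Z$ and every map $h\colon|Z|\to|X|$ such that $|f|\cdot h=|k|$ for some $k\colon Z\to Y$ in $\mathsf{X}$, there is $\bar h\colon Z\to X$ in $\mathsf{X}$ with $|\bar h|=h$. Pre-order enriched: each hom-set $\mathsf{X}(X,Y)$ carries a pre-order $\le$ and composition is monotone; $f\simeq g$ means $f\le g$ and $g\le f$. An object $X$ is separated if for all $f,g\colon Y\to X$, $f\simeq g$ implies $f=g$. An object $Z$ is injective (in the pseudo sense) if for each $|\text{-}|$-initial $y\colon X\to Y$ and each $f\colon X\to Z$ there is $\hat f\colon Y\to Z$ with $\hat f\cdot y\simeq f$. $\mathsf{X}\text{-}\mathsf{Equ}_{\mathrm{sep}}$: objects are pairs $\langle X,\equiv_{|X|}\rangle$ with $X$ a separated object of $\mathsf{X}$ and $\equiv_{|X|}$ an equivalence relation on $|X|$. $\mathsf{X}\text{-}\mathsf{PEqu}_{\mathrm{sep}}$: objects are pairs $\langle X,\equiv_{|X|}\rangle$ with $X$ a separated injective object of $\mathsf{X}$ and $\equiv_{|X|}$ a partial equivalence relation (symmetric and transitive, not necessarily reflexive) on $|X|$. In both categories a morphism $\langle X,\equiv_{|X|}\rangle\to\langle Y,\equiv_{|Y|}\rangle$ is an equivalence class $[f]$ of $\mathsf{X}$-morphisms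 $f\colon X\to Y$ with $|f|$ equivariant ($x\equiv_{|X|}x'$ implies $|f|(x)\equiv_{|Y|}|f|(x')$), where $f,g$ are equivalent iff for all $x,x'\in|X|$, $x\equiv_{|X|}x'$ implies $|f|(x)\equiv_{|Y|}|g|(x')$; composition and identities are induced from $\mathsf{X}$. *)

theory Defs
  imports Main "HOL-Library.FuncSet"
begin

section \<open>Categories, functors, equivalences\<close>

text \<open>
  Hom-sets belonging to different pairs of objects are not required to be disjoint, so identities,
  composition and the action of a functor on morphisms take the objects involved as arguments:
  \<open>Cmp C X Y Z g f\<close> is the composite \<open>g \<cdot> f\<close> of \<open>f : X \<rightarrow> Y\<close> and \<open>g : Y \<rightarrow> Z\<close>.
\<close>

record ('o, 'm) cat =
  Ob  :: "'o set"
  Hom :: "'o \<Rightarrow> 'o \<Rightarrow> 'm set"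
  Idn :: "'o \<Rightarrow> 'm"
  Cmp :: "'o \<Rightarrow> 'o \<Rightarrow> 'o \<Rightarrow> 'm \<Rightarrow> 'm \<Rightarrow> 'm"

locale category =
  fixes C :: "('o, 'm) cat"
  assumes Idn_Hom: "X \<in> Ob C \<Longrightarrow> Idn C X \<in> Hom C X X"
    and Cmp_Hom: "\<lbrakk>X \<in> Ob C; Y \<in> Ob C; Z \<in> Ob C; f \<in> Hom C X Y; g \<in> Hom C Y Z\<rbrakk>
      \<Longrightarrow> Cmp C X Y Z g f \<in> Hom C X Z"
    and Cmp_Idn_right: "\<lbrakk>X \<in> Ob C; Y \<in> Ob C; f \<in> Hom C X Y\<rbrakk>
      \<Longrightarrow> Cmp C X X Y f (Idn C X) = f"
    and Cmp_Idn_left: "\<lbrakk>X \<in> Ob C; Y \<in> Ob C; f \<in> Hom C X Y\<rbrakk>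
      \<Longrightarrow> Cmp C X Y Y (Idn C Y) f = f"
    and Cmp_assoc: "\<lbrakk>X \<in> Ob C; Y \<in> Ob C; Z \<in> Ob C; W \<in> Ob C;
        f \<in> Hom C X Y; g \<in> Hom C Y Z; h \<in> Hom C Z W\<rbrakk>
      \<Longrightarrow> Cmp C X Y W (Cmp C Y Z W h g) f = Cmp C X Z W h (Cmp C X Y Z g f)"

record ('o, 'm, 'p, 'n) funct =
  onOb  :: "'o \<Rightarrow> 'p"
  onMor :: "'o \<Rightarrow> 'o \<Rightarrow> 'm \<Rightarrow> 'n"

locale is_functor = source: category C + target: category D
  for C :: "('o, 'm) cat" and D :: "('p, 'n) cat" +
  fixes F :: "('o, 'm, 'p, 'n) funct"
  assumes onOb_Ob: "X \<in> Ob C \<Longrightarrow> onOb F X \<in> Ob D"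
    and onMor_Hom: "\<lbrakk>X \<in> Ob C; Y \<in> Ob C; f \<in> Hom C X Y\<rbrakk>
      \<Longrightarrow> onMor F X Y f \<in> Hom D (onOb F X) (onOb F Y)"
    and onMor_Idn: "X \<in> Ob C \<Longrightarrow> onMor F X X (Idn C X) = Idn D (onOb F X)"
    and onMor_Cmp: "\<lbrakk>X \<in> Ob C; Y \<in> Ob C; Z \<in> Ob C; f \<in> Hom C X Y; g \<in> Hom C Y Z\<rbrakk>
      \<Longrightarrow> onMor F X Z (Cmp C X Y Z g f)
          = Cmp D (onOb F X) (onOb F Y) (onOb F Z) (onMor F Y Z g) (onMor F X Y f)"

definition id_functor :: "('o, 'm, 'o, 'm) funct" where
  "id_functor = \<lparr>onOb = (\<lambda>X. X), onMor = (\<lambda>X Y f. f)\<rparr>"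

definition comp_functor ::
  "('p, 'n, 'q, 'l) funct \<Rightarrow> ('o, 'm, 'p, 'n) funct \<Rightarrow> ('o, 'm, 'q, 'l) funct" where
  "comp_functor G F = \<lparr>onOb = (\<lambda>X. onOb G (onOb F X)),
     onMor = (\<lambda>X Y f. onMor G (onOb F X) (onOb F Y) (onMor F X Y f))\<rparr>"

definition iso_mor :: "('o, 'm) cat \<Rightarrow> 'o \<Rightarrow> 'o \<Rightarrow> 'm \<Rightarrow> bool" where
  "iso_mor C X Y f \<longleftrightarrow> f \<in> Hom C X Y \<and>
     (\<exists>g\<in>Hom C Y X. Cmp C X Y X g f = Idn C X \<and> Cmp C Y X Y f g = Idn C Y)"

definition natural_iso ::
  "('o, 'm) cat \<Rightarrow> ('p, 'n) cat \<Rightarrow> ('o, 'm, 'p, 'n) funct \<Rightarrow> ('o, 'm, 'p, 'n) funct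
    \<Rightarrow> ('o \<Rightarrow> 'n) \<Rightarrow> bool" where
  "natural_iso C D F G \<eta> \<longleftrightarrow>
     (\<forall>X\<in>Ob C. iso_mor D (onOb F X) (onOb G X) (\<eta> X)) \<and>
     (\<forall>X\<in>Ob C. \<forall>Y\<in>Ob C. \<forall>f\<in>Hom C X Y.
        Cmp D (onOb F X) (onOb F Y) (onOb G Y) (\<eta> Y) (onMor F X Y f)
        = Cmp D (onOb F X) (onOb G X) (onOb G Y) (onMor G X Y f) (\<eta> X))"

definition equivalent_categories :: "('o, 'm) cat \<Rightarrow> ('p, 'n) cat \<Rightarrow> bool" where
  "equivalent_categories C D \<longleftrightarrow>
     category C \<and> category D \<and>
     (\<exists>F G \<eta> \<epsilon>. is_functor C D F \<and> is_functor D C G \<and>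
        natural_iso C C id_functor (comp_functor G F) \<eta> \<and>
        natural_iso D D (comp_functor F G) id_functor \<epsilon>)"

text \<open>\<open>F : C \<rightarrow> D\<close> is left adjoint to \<open>G : D \<rightarrow> C\<close>.\<close>

definition left_adjoint ::
  "('p, 'n) cat \<Rightarrow> ('o, 'm) cat \<Rightarrow> ('p, 'n, 'o, 'm) funct \<Rightarrow> ('o, 'm, 'p, 'n) funct \<Rightarrow> bool" where
  "left_adjoint C D F G \<longleftrightarrow> is_functor C D F \<and> is_functor D C G \<and>
     (\<exists>\<phi>. (\<forall>A\<in>Ob C. \<forall>X\<in>Ob D. bij_betw (\<phi> A X) (Hom D (onOb F A) X) (Hom C A (onOb G X))) \<and>
        (\<forall>A\<in>Ob C. \<forall>B\<in>Ob C. \<forall>X\<in>Ob D. \<forall>a\<in>Hom C B A. \<forall>f\<in>Hom D (onOb F A) X.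
           \<phi> B X (Cmp D (onOb F B) (onOb F A) X f (onMor F B A a))
           = Cmp C B A (onOb G X) (\<phi> A X f) a) \<and>
        (\<forall>A\<in>Ob C. \<forall>X\<in>Ob D. \<forall>Y\<in>Ob D. \<forall>f\<in>Hom D (onOb F A) X. \<forall>g\<in>Hom D X Y.
           \<phi> A Y (Cmp D (onOb F A) X Y g f)
           = Cmp C A (onOb G X) (onOb G Y) (onMor G X Y g) (\<phi> A X f)))"


section \<open>The category of sets\<close>

text \<open>
  HOL has no single type of all sets. The small sets are the members of a collection \<open>\<U>\<close> of sets
  over a type \<open>'a\<close>. Only closure under subsets and the presence of singletons are demanded, so
  \<open>UNIV\<close>, and the small sets of any Grothendieck universe, are instances.
\<close>

definition set_universe :: "'a set set \<Rightarrow> bool" where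
  "set_universe \<U> \<longleftrightarrow> (\<forall>A\<in>\<U>. Pow A \<subseteq> \<U>) \<and> (\<forall>a. {a} \<in> \<U>)"

definition Set_cat :: "'a set set \<Rightarrow> ('a set, 'a \<Rightarrow> 'a) cat" where
  "Set_cat \<U> = \<lparr>Ob = \<U>, Hom = (\<lambda>A B. A \<rightarrow>\<^sub>E B), Idn = (\<lambda>A. restrict id A),
     Cmp = (\<lambda>A B D g f. compose A g f)\<rparr>"

lemma category_Set_cat: "category (Set_cat \<U>)"
proof
  show "Cmp (Set_cat \<U>) X X Y f (Idn (Set_cat \<U>) X) = f"
    if "f \<in> Hom (Set_cat \<U>) X Y" for X Y f
    using that by (force simp: Set_cat_def compose_def fun_eq_iff PiE_def extensional_def)
  show "Cmp (Set_cat \<U>) X Y Y (Idn (Set_cat \<U>) Y) f = f"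
    if "f \<in> Hom (Set_cat \<U>) X Y" for X Y f
    using that by (force simp: Set_cat_def compose_def fun_eq_iff PiE_def extensional_def)
qed (auto simp: Set_cat_def compose_def fun_eq_iff PiE_def extensional_def)


section \<open>Topological functors\<close>

text \<open>
  From here on \<open>U\<close> is a functor from \<open>C\<close> to \<open>Set_cat \<U>\<close>.

  A source is given by the set of its members, each a morphism together with its codomain.
  For a faithful \<open>U\<close> a lifting of a family of maps is the same as a lifting of its set of members,
  so no index classes are needed, and no bound is put on the size of a source.
\<close>

definition initial_source ::
  "('o, 'm) cat \<Rightarrow> ('o, 'm, 'a set, 'a \<Rightarrow> 'a) funct \<Rightarrow> 'o \<Rightarrow> ('o \<times> 'm) set \<Rightarrow> bool" where
  "initial_source C U X T \<longleftrightarrow>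
     X \<in> Ob C \<and> (\<forall>(Y, f)\<in>T. Y \<in> Ob C \<and> f \<in> Hom C X Y) \<and>
     (\<forall>Z\<in>Ob C. \<forall>h\<in>onOb U Z \<rightarrow>\<^sub>E onOb U X.
        (\<forall>(Y, f)\<in>T. \<exists>k\<in>Hom C Z Y. compose (onOb U Z) (onMor U X Y f) h = onMor U Z Y k)
        \<longrightarrow> (\<exists>h'\<in>Hom C Z X. onMor U Z X h' = h))"

definition initial_mor ::
  "('o, 'm) cat \<Rightarrow> ('o, 'm, 'a set, 'a \<Rightarrow> 'a) funct \<Rightarrow> 'o \<Rightarrow> 'o \<Rightarrow> 'm \<Rightarrow> bool" where
  "initial_mor C U X Y f \<longleftrightarrow> initial_source C U X {(Y, f)}"

definition structured_source ::
  "('o, 'm) cat \<Rightarrow> ('o, 'm, 'a set, 'a \<Rightarrow> 'a) funct \<Rightarrow> 'a set \<Rightarrow> ('o \<times> ('a \<Rightarrow> 'a)) set \<Rightarrow> bool" where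
  "structured_source C U A S \<longleftrightarrow> (\<forall>(Y, s)\<in>S. Y \<in> Ob C \<and> s \<in> A \<rightarrow>\<^sub>E onOb U Y)"

definition initial_lifting ::
  "('o, 'm) cat \<Rightarrow> ('o, 'm, 'a set, 'a \<Rightarrow> 'a) funct \<Rightarrow> 'a set \<Rightarrow> ('o \<times> ('a \<Rightarrow> 'a)) set
    \<Rightarrow> 'o \<Rightarrow> ('o \<times> 'm) set \<Rightarrow> bool" where
  "initial_lifting C U A S X T \<longleftrightarrow>
     initial_source C U X T \<and> onOb U X = A \<and> (\<lambda>(Y, f). (Y, onMor U X Y f)) ` T = S"

definition faithful :: "('o, 'm) cat \<Rightarrow> ('o, 'm, 'p, 'n) funct \<Rightarrow> bool" where
  "faithful C F \<longleftrightarrow> (\<forall>X\<in>Ob C. \<forall>Y\<in>Ob C. inj_on (onMor F X Y) (Hom C X Y))"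

text \<open>
  Faithfulness has to be an explicit requirement here: its usual derivation from the existence of
  unique liftings uses sources with repeated members.
\<close>

definition topological ::
  "'a set set \<Rightarrow> ('o, 'm) cat \<Rightarrow> ('o, 'm, 'a set, 'a \<Rightarrow> 'a) funct \<Rightarrow> bool" where
  "topological \<U> C U \<longleftrightarrow> is_functor C (Set_cat \<U>) U \<and> faithful C U \<and>
     (\<forall>A\<in>\<U>. \<forall>S. structured_source C U A S \<longrightarrow> (\<exists>!(X, T). initial_lifting C U A S X T))"


section \<open>Pre-order enrichment\<close>

definition preorder_enriched ::
  "('o, 'm) cat \<Rightarrow> ('o \<Rightarrow> 'o \<Rightarrow> 'm \<Rightarrow> 'm \<Rightarrow> bool) \<Rightarrow> bool" where
  "preorder_enriched C le \<longleftrightarrow>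
     (\<forall>X\<in>Ob C. \<forall>Y\<in>Ob C. reflp_on (Hom C X Y) (le X Y) \<and> transp_on (Hom C X Y) (le X Y)) \<and>
     (\<forall>X\<in>Ob C. \<forall>Y\<in>Ob C. \<forall>Z\<in>Ob C. \<forall>f\<in>Hom C X Y. \<forall>f'\<in>Hom C X Y. \<forall>g\<in>Hom C Y Z. \<forall>g'\<in>Hom C Y Z.
        le X Y f f' \<longrightarrow> le Y Z g g' \<longrightarrow> le X Z (Cmp C X Y Z g f) (Cmp C X Y Z g' f'))"

definition simeq :: "('o \<Rightarrow> 'o \<Rightarrow> 'm \<Rightarrow> 'm \<Rightarrow> bool) \<Rightarrow> 'o \<Rightarrow> 'o \<Rightarrow> 'm \<Rightarrow> 'm \<Rightarrow> bool" where
  "simeq le X Y f g \<longleftrightarrow> le X Y f g \<and> le X Y g f"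

definition separated ::
  "('o, 'm) cat \<Rightarrow> ('o \<Rightarrow> 'o \<Rightarrow> 'm \<Rightarrow> 'm \<Rightarrow> bool) \<Rightarrow> 'o \<Rightarrow> bool" where
  "separated C le X \<longleftrightarrow> X \<in> Ob C \<and>
     (\<forall>Y\<in>Ob C. \<forall>f\<in>Hom C Y X. \<forall>g\<in>Hom C Y X. simeq le Y X f g \<longrightarrow> f = g)"

definition injective ::
  "('o, 'm) cat \<Rightarrow> ('o, 'm, 'a set, 'a \<Rightarrow> 'a) funct \<Rightarrow> ('o \<Rightarrow> 'o \<Rightarrow> 'm \<Rightarrow> 'm \<Rightarrow> bool) \<Rightarrow> 'o \<Rightarrow> bool"
  where
  "injective C U le Z \<longleftrightarrow> Z \<in> Ob C \<and>
     (\<forall>X\<in>Ob C. \<forall>Y\<in>Ob C. \<forall>y\<in>Hom C X Y. \<forall>f\<in>Hom C X Z. initial_mor C U X Y y \<longrightarrow>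
        (\<exists>f'\<in>Hom C Y Z. simeq le X Z (Cmp C X Y Z f' y) f))"

definition enough_injectives ::
  "('o, 'm) cat \<Rightarrow> ('o, 'm, 'a set, 'a \<Rightarrow> 'a) funct \<Rightarrow> ('o \<Rightarrow> 'o \<Rightarrow> 'm \<Rightarrow> 'm \<Rightarrow> bool) \<Rightarrow> bool" where
  "enough_injectives C U le \<longleftrightarrow>
     (\<forall>X\<in>Ob C. \<exists>X'\<in>Ob C. \<exists>y\<in>Hom C X X'. initial_mor C U X X' y \<and> injective C U le X' \<and>
        (separated C le X \<longrightarrow> separated C le X'))"


section \<open>Objects with (partial) equivalence relations\<close>

definition partial_equiv :: "'a set \<Rightarrow> ('a \<times> 'a) set \<Rightarrow> bool" where
  "partial_equiv A r \<longleftrightarrow> r \<subseteq> A \<times> A \<and> sym r \<and> trans r"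

definition equivariant_mors ::
  "('o, 'm) cat \<Rightarrow> ('o, 'm, 'a set, 'a \<Rightarrow> 'a) funct
    \<Rightarrow> 'o \<times> ('a \<times> 'a) set \<Rightarrow> 'o \<times> ('a \<times> 'a) set \<Rightarrow> 'm set" where
  "equivariant_mors C U = (\<lambda>(X, r) (Y, s).
     {f \<in> Hom C X Y. \<forall>(x, x')\<in>r. (onMor U X Y f x, onMor U X Y f x') \<in> s})"

definition mor_equiv ::
  "('o, 'm) cat \<Rightarrow> ('o, 'm, 'a set, 'a \<Rightarrow> 'a) funct
    \<Rightarrow> 'o \<times> ('a \<times> 'a) set \<Rightarrow> 'o \<times> ('a \<times> 'a) set \<Rightarrow> ('m \<times> 'm) set" where
  "mor_equiv C U P Q =
     {(f, g). f \<in> equivariant_mors C U P Q \<and> g \<in> equivariant_mors C U P Q \<and>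
        (\<forall>(x, x')\<in>snd P. (onMor U (fst P) (fst Q) f x, onMor U (fst P) (fst Q) g x') \<in> snd Q)}"

text \<open>
  The composite of two classes is the union of the classes of all composites of representatives;
  these all coincide, so this is the class of any one of them.
\<close>

definition rel_cat ::
  "('o, 'm) cat \<Rightarrow> ('o, 'm, 'a set, 'a \<Rightarrow> 'a) funct \<Rightarrow> ('o \<times> ('a \<times> 'a) set) set
    \<Rightarrow> ('o \<times> ('a \<times> 'a) set, 'm set) cat" where
  "rel_cat C U \<O> = \<lparr>Ob = \<O>,
     Hom = (\<lambda>P Q. equivariant_mors C U P Q // mor_equiv C U P Q),
     Idn = (\<lambda>P. mor_equiv C U P P `` {Idn C (fst P)}),
     Cmp = (\<lambda>P Q R \<gamma> \<phi>. \<Union>g\<in>\<gamma>. \<Union>f\<in>\<phi>.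
        mor_equiv C U P R `` {Cmp C (fst P) (fst Q) (fst R) g f})\<rparr>"

definition Equ_sep ::
  "('o, 'm) cat \<Rightarrow> ('o, 'm, 'a set, 'a \<Rightarrow> 'a) funct \<Rightarrow> ('o \<Rightarrow> 'o \<Rightarrow> 'm \<Rightarrow> 'm \<Rightarrow> bool)
    \<Rightarrow> ('o \<times> ('a \<times> 'a) set, 'm set) cat" where
  "Equ_sep C U le = rel_cat C U {(X, r). separated C le X \<and> equiv (onOb U X) r}"

definition PEqu_sep ::
  "('o, 'm) cat \<Rightarrow> ('o, 'm, 'a set, 'a \<Rightarrow> 'a) funct \<Rightarrow> ('o \<Rightarrow> 'o \<Rightarrow> 'm \<Rightarrow> 'm \<Rightarrow> bool)
    \<Rightarrow> ('o \<times> ('a \<times> 'a) set, 'm set) cat" where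
  "PEqu_sep C U le = rel_cat C U
     {(X, r). separated C le X \<and> injective C U le X \<and> partial_equiv (onOb U X) r}"

end

theory Submission
  imports Defs
begin

text \<open>
  The equivalence is given by a functor that sends \<open>(X, r)\<close>, where \<open>X\<close> is separated and \<open>r\<close> is an
  equivalence relation, to \<open>(hull X, y r)\<close>. Here \<open>y : X \<rightarrow> hull X\<close> is an initial morphism into a
  separated injective object, and \<open>y r\<close> is the image of \<open>r\<close> under \<open>|y|\<close>, whose domain is the image of
  \<open>|y|\<close>. Nothing is lost in passing from \<open>r\<close> to \<open>y r\<close>, because \<open>|y|\<close> is injective
  (\<open>initial_from_separated_inj\<close>): elements of \<open>|X|\<close> are morphisms \<open>\<one> \<rightarrow> X\<close>, initial morphisms
  reflect \<open>\<simeq>\<close> between those, and \<open>\<simeq>\<close> is equality in \<open>X\<close>.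

  Morphisms are compared through commutative squares (\<open>extends\<close>) \<open>g \<cdot> y = y \<cdot> f\<close>, with \<open>f : X \<rightarrow> Y\<close> and
  \<open>g : hull X \<rightarrow> hull Y\<close>. In such a square, \<open>f\<close> is equivariant iff \<open>g\<close> is, and two squares have
  equivalent \<open>f\<close> iff they have equivalent \<open>g\<close>, since only the points \<open>|y| x\<close> are self-related
  (\<open>extends_equivar_iff\<close>, \<open>extends_cls_eq_iff\<close>). Each equivariant \<open>f\<close> is part of a square because
  \<open>hull Y\<close> is injective and separated (\<open>extends_exists\<close>). Each equivariant \<open>g\<close> is part of a square
  because \<open>r\<close> is reflexive: \<open>g \<cdot> y\<close> takes values in the domain of the image relation, which is the
  image of \<open>Y\<close>, so it factors through the initial morphism \<open>Y \<rightarrow> hull Y\<close> (\<open>restricts_exists\<close>).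
  The functor is therefore well defined, full and faithful.

  For essential surjectivity (\<open>hull_functor_essentially_surjective\<close>), let \<open>r\<close> be a partial
  equivalence relation on a separated injective \<open>Z\<close>. The topological functor provides an initial
  \<open>m : X \<rightarrow> Z\<close> over the inclusion of the domain of \<open>r\<close>, on which \<open>r\<close> is an equivalence relation. Both
  \<open>Z\<close> and \<open>hull X\<close> are separated and injective and receive an initial morphism from \<open>X\<close>, so there are morphisms
  \<open>hull X \<rightarrow> Z\<close> and \<open>Z \<rightarrow> hull X\<close> under \<open>X\<close>. They are usually not inverse to each other, but they
  are so on the image of \<open>X\<close>, which is all that their classes see.
\<close>

section \<open>Fully faithful, essentially surjective functors\<close>

text \<open>
  For each \<open>W\<close> choose a preimage \<open>G0 W\<close> together with an isomorphism \<open>e W : F (G0 W) \<rightarrow> W\<close> and its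
  inverse \<open>d W\<close>. The inverse functor sends \<open>g\<close> to the morphism that \<open>F\<close> maps to the conjugate
  \<open>d \<cdot> g \<cdot> e\<close>, and faithfulness of \<open>F\<close> lets all equations be checked in \<open>D\<close>.
\<close>

lemma (in is_functor) equivalence_if_fully_faithful_essentially_surjective:
  assumes ff: "\<And>X Y. \<lbrakk>X \<in> Ob C; Y \<in> Ob C\<rbrakk>
      \<Longrightarrow> bij_betw (onMor F X Y) (Hom C X Y) (Hom D (onOb F X) (onOb F Y))"
    and es: "\<And>W. W \<in> Ob D \<Longrightarrow> \<exists>X\<in>Ob C. \<exists>e. iso_mor D (onOb F X) W e"
  shows "equivalent_categories C D"
proof -
  have "\<forall>W\<in>Ob D. \<exists>X e d. X \<in> Ob C \<and> e \<in> Hom D (onOb F X) W \<and> d \<in> Hom D W (onOb F X) \<and>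
      Cmp D (onOb F X) W (onOb F X) d e = Idn D (onOb F X) \<and> Cmp D W (onOb F X) W e d = Idn D W"
    using es unfolding iso_mor_def by blast
  then obtain G0 e d where choice: "\<forall>W\<in>Ob D. G0 W \<in> Ob C \<and> e W \<in> Hom D (onOb F (G0 W)) W \<and>
      d W \<in> Hom D W (onOb F (G0 W)) \<and>
      Cmp D (onOb F (G0 W)) W (onOb F (G0 W)) (d W) (e W) = Idn D (onOb F (G0 W)) \<and>
      Cmp D W (onOb F (G0 W)) W (e W) (d W) = Idn D W"
    by metis
  define T where "T W = onOb F (G0 W)" for W
  have G0: "G0 W \<in> Ob C" and T: "T W \<in> Ob D" and e: "e W \<in> Hom D (T W) W" and d: "d W \<in> Hom D W (T W)"
    and de: "Cmp D (T W) W (T W) (d W) (e W) = Idn D (T W)"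
    and ed: "Cmp D W (T W) W (e W) (d W) = Idn D W" if "W \<in> Ob D" for W
    using choice that by (auto simp: T_def onOb_Ob)
  have FT: "onOb F (G0 W) = T W" for W by (simp add: T_def)
  define pre where "pre X Y = inv_into (Hom C X Y) (onMor F X Y)" for X Y
  have pre_Hom: "pre X Y g \<in> Hom C X Y" and F_pre: "onMor F X Y (pre X Y g) = g"
    if "X \<in> Ob C" "Y \<in> Ob C" "g \<in> Hom D (onOb F X) (onOb F Y)" for X Y g
    using bij_betw_imp_surj_on[OF ff[OF that(1,2)]] that(3)
    by (auto simp: pre_def intro!: inv_into_into f_inv_into_f)
  have F_cancel: "f = g" if "X \<in> Ob C" "Y \<in> Ob C" "f \<in> Hom C X Y" "g \<in> Hom C X Y"
    "onMor F X Y f = onMor F X Y g" for X Y f g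
    using bij_betw_imp_inj_on[OF ff[OF that(1,2)]] that(3-) by (auto dest: inj_onD)
  define conj where "conj V W g = Cmp D (T V) W (T W) (d W) (Cmp D (T V) V W g (e V))" for V W g
  have conj_Hom: "conj V W g \<in> Hom D (T V) (T W)"
    and e_conj: "Cmp D (T V) (T W) W (e W) (conj V W g) = Cmp D (T V) V W g (e V)"
    and conj_d: "Cmp D V (T V) (T W) (conj V W g) (d V) = Cmp D V W (T W) (d W) g"
    if VW: "V \<in> Ob D" "W \<in> Ob D" and g: "g \<in> Hom D V W" for V W g
  proof -
    note [simp] = VW g T e d target.Cmp_Hom
    show "conj V W g \<in> Hom D (T V) (T W)" by (simp add: conj_def)
    show "Cmp D (T V) (T W) W (e W) (conj V W g) = Cmp D (T V) V W g (e V)"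
      unfolding conj_def
      by (subst target.Cmp_assoc[symmetric]) (simp_all add: ed target.Cmp_Idn_left)
    have "Cmp D V (T V) (T W) (conj V W g) (d V)
        = Cmp D V W (T W) (d W) (Cmp D V V W g (Cmp D V (T V) V (e V) (d V)))"
      by (simp add: conj_def target.Cmp_assoc)
    also have "\<dots> = Cmp D V W (T W) (d W) g" by (simp add: ed target.Cmp_Idn_right)
    finally show "Cmp D V (T V) (T W) (conj V W g) (d V) = Cmp D V W (T W) (d W) g" .
  qed
  \<comment> \<open>\<open>conj V W g\<close> is characterised by its naturality square, which makes \<open>conj\<close> functorial.\<close>
  have conj_unique: "k = conj V W g"
    if VW: "V \<in> Ob D" "W \<in> Ob D" and g: "g \<in> Hom D V W" and k: "k \<in> Hom D (T V) (T W)"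
      and eq: "Cmp D (T V) (T W) W (e W) k = Cmp D (T V) V W g (e V)" for V W g k
  proof -
    have "k = Cmp D (T V) (T W) (T W) (Cmp D (T W) W (T W) (d W) (e W)) k"
      using VW k by (simp add: de T target.Cmp_Idn_left)
    also have "\<dots> = Cmp D (T V) W (T W) (d W) (Cmp D (T V) (T W) W (e W) k)"
      using VW k by (simp add: T e d target.Cmp_assoc)
    also have "\<dots> = conj V W g" by (simp add: conj_def eq)
    finally show ?thesis .
  qed
  define G where "G = \<lparr>onOb = G0, onMor = (\<lambda>V W g. pre (G0 V) (G0 W) (conj V W g))\<rparr>"
  have G_Hom: "onMor G V W g \<in> Hom C (G0 V) (G0 W)"
    and FG: "onMor F (G0 V) (G0 W) (onMor G V W g) = conj V W g"
    if "V \<in> Ob D" "W \<in> Ob D" "g \<in> Hom D V W" for V W g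
    using pre_Hom[of "G0 V" "G0 W" "conj V W g"] F_pre[of "G0 V" "G0 W" "conj V W g"]
      conj_Hom[OF that] G0 that
    by (simp_all add: G_def FT)
  have G: "is_functor D C G"
  proof
    fix W assume W: "W \<in> Ob D"
    show "onOb G W \<in> Ob C" using G0 W by (simp add: G_def)
    have id: "Idn D W \<in> Hom D W W" by (simp add: W target.Idn_Hom)
    have "Idn D (T W) = conj W W (Idn D W)"
      by (rule conj_unique)
        (simp_all add: W T e target.Idn_Hom target.Cmp_Idn_left target.Cmp_Idn_right)
    then have "onMor G W W (Idn D W) = Idn C (G0 W)"
      by (intro F_cancel[of "G0 W" "G0 W"]) (simp_all add: W G0 G_Hom id source.Idn_Hom onMor_Idn FG FT)
    then show "onMor G W W (Idn D W) = Idn C (onOb G W)" by (simp add: G_def)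
  next
    fix V W g assume "V \<in> Ob D" "W \<in> Ob D" "g \<in> Hom D V W"
    then show "onMor G V W g \<in> Hom C (onOb G V) (onOb G W)"
      using G_Hom by (simp add: G_def)
  next
    fix V W Z g h
    assume [simp]: "V \<in> Ob D" "W \<in> Ob D" "Z \<in> Ob D" "g \<in> Hom D V W" "h \<in> Hom D W Z"
    note [simp] = T e conj_Hom target.Cmp_Hom source.Cmp_Hom G0 G_Hom
    have "Cmp D (T V) (T Z) Z (e Z) (Cmp D (T V) (T W) (T Z) (conj W Z h) (conj V W g))
        = Cmp D (T V) (T W) Z (Cmp D (T W) (T Z) Z (e Z) (conj W Z h)) (conj V W g)"
      by (rule target.Cmp_assoc[symmetric]) simp_all
    also have "\<dots> = Cmp D (T V) W Z h (Cmp D (T V) (T W) W (e W) (conj V W g))"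
      unfolding e_conj[OF \<open>W \<in> Ob D\<close> \<open>Z \<in> Ob D\<close> \<open>h \<in> Hom D W Z\<close>]
      by (rule target.Cmp_assoc) simp_all
    also have "\<dots> = Cmp D (T V) V Z (Cmp D V W Z h g) (e V)"
      by (simp add: e_conj target.Cmp_assoc)
    finally have "Cmp D (T V) (T W) (T Z) (conj W Z h) (conj V W g) = conj V Z (Cmp D V W Z h g)"
      by (intro conj_unique) simp_all
    then have "onMor G V Z (Cmp D V W Z h g)
        = Cmp C (G0 V) (G0 W) (G0 Z) (onMor G W Z h) (onMor G V W g)"
      by (intro F_cancel[of "G0 V" "G0 Z"]) (simp_all add: onMor_Cmp FG FT)
    then show "onMor G V Z (Cmp D V W Z h g)
        = Cmp C (onOb G V) (onOb G W) (onOb G Z) (onMor G W Z h) (onMor G V W g)"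
      by (simp add: G_def)
  qed
  have counit: "natural_iso D D (comp_functor F G) id_functor e"
    unfolding natural_iso_def iso_mor_def
    by (auto simp: comp_functor_def id_functor_def G_def[THEN arg_cong[of _ _ onOb], simplified]
        FT FG e_conj e intro!: bexI[OF _ d] de ed)
  define \<eta> where "\<eta> X = pre X (G0 (onOb F X)) (d (onOb F X))" for X
  define \<theta> where "\<theta> X = pre (G0 (onOb F X)) X (e (onOb F X))" for X
  have \<eta>: "\<eta> X \<in> Hom C X (G0 (onOb F X))" "onMor F X (G0 (onOb F X)) (\<eta> X) = d (onOb F X)"
    and \<theta>: "\<theta> X \<in> Hom C (G0 (onOb F X)) X" "onMor F (G0 (onOb F X)) X (\<theta> X) = e (onOb F X)"
    if "X \<in> Ob C" for X
    using that pre_Hom F_pre d e onOb_Ob G0 by (simp_all add: \<eta>_def \<theta>_def FT)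
  have unit: "natural_iso C C id_functor (comp_functor G F) \<eta>"
    unfolding natural_iso_def
  proof (intro conjI ballI)
    fix X assume [simp]: "X \<in> Ob C"
    note [simp] = onOb_Ob G0 \<eta> \<theta> source.Cmp_Hom source.Idn_Hom
    have "Cmp C X (G0 (onOb F X)) X (\<theta> X) (\<eta> X) = Idn C X"
      by (rule F_cancel[of X X]) (simp_all add: onMor_Cmp onMor_Idn FT ed)
    moreover have "Cmp C (G0 (onOb F X)) X (G0 (onOb F X)) (\<eta> X) (\<theta> X) = Idn C (G0 (onOb F X))"
      by (rule F_cancel[of "G0 (onOb F X)" "G0 (onOb F X)"])
        (simp_all add: onMor_Cmp onMor_Idn FT de)
    ultimately show "iso_mor C (onOb id_functor X) (onOb (comp_functor G F) X) (\<eta> X)"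
      unfolding iso_mor_def id_functor_def comp_functor_def G_def
      by (auto intro!: bexI[of _ "\<theta> X"])
  next
    fix X Y f assume [simp]: "X \<in> Ob C" "Y \<in> Ob C" "f \<in> Hom C X Y"
    note [simp] = onOb_Ob onMor_Hom G0 \<eta> source.Cmp_Hom G_Hom
    have "Cmp C X Y (G0 (onOb F Y)) (\<eta> Y) f
        = Cmp C X (G0 (onOb F X)) (G0 (onOb F Y)) (onMor G (onOb F X) (onOb F Y) (onMor F X Y f)) (\<eta> X)"
      by (rule F_cancel[of X "G0 (onOb F Y)"]) (simp_all add: onMor_Cmp FG conj_d FT)
    then show "Cmp C (onOb id_functor X) (onOb id_functor Y) (onOb (comp_functor G F) Y) (\<eta> Y)
          (onMor id_functor X Y f)
        = Cmp C (onOb id_functor X) (onOb (comp_functor G F) X) (onOb (comp_functor G F) Y)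
          (onMor (comp_functor G F) X Y f) (\<eta> X)"
      by (simp add: id_functor_def comp_functor_def G_def)
  qed
  show ?thesis
    unfolding equivalent_categories_def
    using source.category_axioms target.category_axioms is_functor_axioms G unit counit by blast
qed


section \<open>Concrete categories and their categories of partial equivalence relations\<close>

locale concrete_category = is_functor C "Set_cat \<U>" U
  for C :: "('o, 'm) cat" and \<U> :: "'a set set" and U :: "('o, 'm, 'a set, 'a \<Rightarrow> 'a) funct" +
  assumes faithful_U: "faithful C U"
begin

lemma onMor_PiE:
  assumes "X \<in> Ob C" "Y \<in> Ob C" "f \<in> Hom C X Y"
  shows "onMor U X Y f \<in> onOb U X \<rightarrow>\<^sub>E onOb U Y"
  using onMor_Hom[OF assms] by (simp add: Set_cat_def)

lemma onMor_mem:
  assumes "X \<in> Ob C" "Y \<in> Ob C" "f \<in> Hom C X Y" "x \<in> onOb U X"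
  shows "onMor U X Y f x \<in> onOb U Y"
  using onMor_PiE[OF assms(1-3)] assms(4) by blast

lemma onMor_Idn_apply:
  assumes "X \<in> Ob C" "x \<in> onOb U X"
  shows "onMor U X X (Idn C X) x = x"
  using onMor_Idn[OF assms(1)] assms(2) by (simp add: Set_cat_def)

lemma onMor_Cmp_compose:
  assumes "X \<in> Ob C" "Y \<in> Ob C" "Z \<in> Ob C" "f \<in> Hom C X Y" "g \<in> Hom C Y Z"
  shows "onMor U X Z (Cmp C X Y Z g f) = compose (onOb U X) (onMor U Y Z g) (onMor U X Y f)"
  using onMor_Cmp[OF assms] by (simp add: Set_cat_def)

lemma onMor_Cmp_apply:
  assumes "X \<in> Ob C" "Y \<in> Ob C" "Z \<in> Ob C" "f \<in> Hom C X Y" "g \<in> Hom C Y Z" "x \<in> onOb U X"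
  shows "onMor U X Z (Cmp C X Y Z g f) x = onMor U Y Z g (onMor U X Y f x)"
  using onMor_Cmp_compose[OF assms(1-5)] assms(6) by (simp add: compose_def)

text \<open>
  Equality of morphisms is tested on elements, which is how faithfulness enters from here on.
\<close>

lemma mor_eqI:
  assumes "X \<in> Ob C" "Y \<in> Ob C" "f \<in> Hom C X Y" "g \<in> Hom C X Y"
    and "\<And>x. x \<in> onOb U X \<Longrightarrow> onMor U X Y f x = onMor U X Y g x"
  shows "f = g"
proof -
  have "onMor U X Y f = onMor U X Y g"
    using PiE_ext[OF onMor_PiE onMor_PiE] assms by blast
  then show ?thesis
    using faithful_U assms(1-4) unfolding faithful_def by (blast dest: inj_onD)
qed

text \<open>
  Both categories of the theorem are full subcategories of the category on these objects, so that
  classes of morphisms and their composition can be treated once.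
\<close>

definition per_obs :: "('o \<times> ('a \<times> 'a) set) set" where
  "per_obs = {(X, r). X \<in> Ob C \<and> partial_equiv (onOb U X) r}"

lemma per_obsD:
  assumes "P \<in> per_obs"
  shows "fst P \<in> Ob C" "sym (snd P)" "trans (snd P)"
    "(x, x') \<in> snd P \<Longrightarrow> x \<in> onOb U (fst P)" "(x, x') \<in> snd P \<Longrightarrow> x' \<in> onOb U (fst P)"
  using assms by (auto simp: per_obs_def partial_equiv_def)

lemma per_refl:
  assumes "P \<in> per_obs" "(x, x') \<in> snd P"
  shows "(x, x) \<in> snd P" "(x', x') \<in> snd P"
  using per_obsD(2,3)[OF assms(1)] assms(2) by (meson symD transD)+

abbreviation equivar where "equivar \<equiv> equivariant_mors C U"
abbreviation cls where "cls P Q f \<equiv> mor_equiv C U P Q `` {f}"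

lemma equivar_iff:
  "f \<in> equivar P Q \<longleftrightarrow> f \<in> Hom C (fst P) (fst Q) \<and>
    (\<forall>x x'. (x, x') \<in> snd P \<longrightarrow>
      (onMor U (fst P) (fst Q) f x, onMor U (fst P) (fst Q) f x') \<in> snd Q)"
  by (cases P; cases Q) (auto simp: equivariant_mors_def)

lemma mor_equiv_iff:
  "(f, g) \<in> mor_equiv C U P Q \<longleftrightarrow> f \<in> equivar P Q \<and> g \<in> equivar P Q \<and>
    (\<forall>x x'. (x, x') \<in> snd P \<longrightarrow>
      (onMor U (fst P) (fst Q) f x, onMor U (fst P) (fst Q) g x') \<in> snd Q)"
  by (auto simp: mor_equiv_def)

lemma equiv_mor_equiv:
  assumes "P \<in> per_obs" "Q \<in> per_obs"
  shows "equiv (equivar P Q) (mor_equiv C U P Q)"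
proof (rule equivI)
  show "mor_equiv C U P Q \<subseteq> equivar P Q \<times> equivar P Q" by (auto simp: mor_equiv_iff)
  show "refl_on (equivar P Q) (mor_equiv C U P Q)"
    by (auto simp: refl_on_def mor_equiv_iff equivar_iff)
  show "sym (mor_equiv C U P Q)"
    unfolding sym_def mor_equiv_iff
    using per_obsD(2)[OF assms(1)] per_obsD(2)[OF assms(2)] by (meson symD)
  show "trans (mor_equiv C U P Q)"
    unfolding trans_def mor_equiv_iff
    using per_refl(1)[OF assms(1)] per_obsD(3)[OF assms(2)] by (meson transD)
qed

text \<open>
  Since relations are symmetric and transitive, agreement up to the target relation needs to be
  tested only on the self-related points of the source.
\<close>

lemma mor_equiv_iff_pointwise:
  assumes P: "P \<in> per_obs" and Q: "Q \<in> per_obs" and f: "f \<in> equivar P Q" and g: "g \<in> equivar P Q"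
  shows "(f, g) \<in> mor_equiv C U P Q \<longleftrightarrow>
    (\<forall>x. (x, x) \<in> snd P \<longrightarrow> (onMor U (fst P) (fst Q) f x, onMor U (fst P) (fst Q) g x) \<in> snd Q)"
  using per_refl(1)[OF P] f g per_obsD(3)[OF Q]
  unfolding mor_equiv_iff equivar_iff by (meson transD)

lemma cls_eq_iff:
  assumes "P \<in> per_obs" "Q \<in> per_obs" "f \<in> equivar P Q" "g \<in> equivar P Q"
  shows "cls P Q f = cls P Q g \<longleftrightarrow>
    (\<forall>x. (x, x) \<in> snd P \<longrightarrow> (onMor U (fst P) (fst Q) f x, onMor U (fst P) (fst Q) g x) \<in> snd Q)"
  using eq_equiv_class_iff[OF equiv_mor_equiv] mor_equiv_iff_pointwise assms by blast

lemma cls_eqI: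
  assumes "P \<in> per_obs" "Q \<in> per_obs" "f \<in> equivar P Q" "g \<in> equivar P Q"
    and "\<And>x. (x, x) \<in> snd P \<Longrightarrow> onMor U (fst P) (fst Q) f x = onMor U (fst P) (fst Q) g x"
  shows "cls P Q f = cls P Q g"
proof -
  have "(onMor U (fst P) (fst Q) f x, onMor U (fst P) (fst Q) g x) \<in> snd Q" if "(x, x) \<in> snd P" for x
    using assms(3) that unfolding assms(5)[OF that, symmetric] equivar_iff by blast
  then show ?thesis using cls_eq_iff[OF assms(1-4)] by blast
qed

lemma Idn_equivar:
  assumes "P \<in> per_obs"
  shows "Idn C (fst P) \<in> equivar P P"
  using per_obsD[OF assms] by (auto simp: equivar_iff source.Idn_Hom onMor_Idn_apply)

lemma Cmp_equivar:
  assumes "P \<in> per_obs" "Q \<in> per_obs" "R \<in> per_obs" "f \<in> equivar P Q" "g \<in> equivar Q R"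
  shows "Cmp C (fst P) (fst Q) (fst R) g f \<in> equivar P R"
  using assms per_obsD(4,5)[OF assms(1)] per_obsD(1)
  by (auto simp: equivar_iff source.Cmp_Hom onMor_Cmp_apply)

lemma Ob_rel_cat: "Ob (rel_cat C U \<O>) = \<O>"
  by (simp add: rel_cat_def)

lemma Hom_rel_cat: "Hom (rel_cat C U \<O>) P Q = cls P Q ` equivar P Q"
  by (auto simp: rel_cat_def quotient_def)

lemma Idn_rel_cat: "Idn (rel_cat C U \<O>) P = cls P P (Idn C (fst P))"
  by (simp add: rel_cat_def)

text \<open>
  The union that defines the composite of two classes is constant: replacing the
  representatives by equivalent ones does not change the class of their composite.
\<close>

lemma Cmp_rel_cat:
  assumes P: "P \<in> per_obs" and Q: "Q \<in> per_obs" and R: "R \<in> per_obs"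
    and f: "f \<in> equivar P Q" and g: "g \<in> equivar Q R"
  shows "Cmp (rel_cat C U \<O>) P Q R (cls Q R g) (cls P Q f)
    = cls P R (Cmp C (fst P) (fst Q) (fst R) g f)"
proof -
  have *: "cls P R (Cmp C (fst P) (fst Q) (fst R) g' f') = cls P R (Cmp C (fst P) (fst Q) (fst R) g f)"
    if "g' \<in> cls Q R g" "f' \<in> cls P Q f" for g' f'
  proof -
    have gg: "(g, g') \<in> mor_equiv C U Q R" and ff: "(f, f') \<in> mor_equiv C U P Q"
      using that by auto
    then have E: "g' \<in> equivar Q R" "f' \<in> equivar P Q" by (auto simp: mor_equiv_iff)
    have "(Cmp C (fst P) (fst Q) (fst R) g f, Cmp C (fst P) (fst Q) (fst R) g' f')
        \<in> mor_equiv C U P R"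
      using gg ff E f g Cmp_equivar P Q R per_obsD(1) per_obsD(4,5)[OF P]
      by (auto simp: mor_equiv_iff onMor_Cmp_apply equivar_iff[THEN iffD1])
    then show ?thesis
      using equiv_class_eq[OF equiv_mor_equiv[OF P R]] by blast
  qed
  have "f \<in> cls P Q f" "g \<in> cls Q R g"
    using equiv_class_self[OF equiv_mor_equiv] P Q R f g by blast+
  then have "(\<Union>g'\<in>cls Q R g. \<Union>f'\<in>cls P Q f. cls P R (Cmp C (fst P) (fst Q) (fst R) g' f'))
      = cls P R (Cmp C (fst P) (fst Q) (fst R) g f)"
    using * by blast
  then show ?thesis by (simp add: rel_cat_def)
qed

lemma category_rel_cat:
  assumes "\<O> \<subseteq> per_obs"
  shows "category (rel_cat C U \<O>)"
proof
  fix P assume "P \<in> Ob (rel_cat C U \<O>)"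
  then have "P \<in> per_obs" using assms by (auto simp: Ob_rel_cat)
  then show "Idn (rel_cat C U \<O>) P \<in> Hom (rel_cat C U \<O>) P P"
    using Idn_equivar by (auto simp: Hom_rel_cat Idn_rel_cat)
next
  fix P Q R \<phi> \<gamma>
  assume "P \<in> Ob (rel_cat C U \<O>)" "Q \<in> Ob (rel_cat C U \<O>)" "R \<in> Ob (rel_cat C U \<O>)"
    and H: "\<phi> \<in> Hom (rel_cat C U \<O>) P Q" "\<gamma> \<in> Hom (rel_cat C U \<O>) Q R"
  then have "P \<in> per_obs" "Q \<in> per_obs" "R \<in> per_obs" using assms by (auto simp: Ob_rel_cat)
  then show "Cmp (rel_cat C U \<O>) P Q R \<gamma> \<phi> \<in> Hom (rel_cat C U \<O>) P R"
    using H by (auto simp: Hom_rel_cat Cmp_rel_cat intro!: imageI Cmp_equivar)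
next
  fix P Q \<phi>
  assume "P \<in> Ob (rel_cat C U \<O>)" "Q \<in> Ob (rel_cat C U \<O>)"
    and H: "\<phi> \<in> Hom (rel_cat C U \<O>) P Q"
  then have PQ: "P \<in> per_obs" "Q \<in> per_obs" using assms by (auto simp: Ob_rel_cat)
  obtain f where f: "f \<in> equivar P Q" "\<phi> = cls P Q f" using H by (auto simp: Hom_rel_cat)
  then have "f \<in> Hom C (fst P) (fst Q)" by (simp add: equivar_iff)
  then show "Cmp (rel_cat C U \<O>) P P Q \<phi> (Idn (rel_cat C U \<O>) P) = \<phi>"
    "Cmp (rel_cat C U \<O>) P Q Q (Idn (rel_cat C U \<O>) Q) \<phi> = \<phi>"
    using f PQ per_obsD(1)
    by (simp_all add: Idn_rel_cat Cmp_rel_cat Idn_equivar source.Cmp_Idn_left source.Cmp_Idn_right)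
next
  fix P Q R S \<phi> \<gamma> \<chi>
  assume "P \<in> Ob (rel_cat C U \<O>)" "Q \<in> Ob (rel_cat C U \<O>)" "R \<in> Ob (rel_cat C U \<O>)"
      "S \<in> Ob (rel_cat C U \<O>)"
    and H: "\<phi> \<in> Hom (rel_cat C U \<O>) P Q" "\<gamma> \<in> Hom (rel_cat C U \<O>) Q R"
      "\<chi> \<in> Hom (rel_cat C U \<O>) R S"
  then have PQRS: "P \<in> per_obs" "Q \<in> per_obs" "R \<in> per_obs" "S \<in> per_obs"
    using assms by (auto simp: Ob_rel_cat)
  obtain f g h where E: "f \<in> equivar P Q" "g \<in> equivar Q R" "h \<in> equivar R S"
    and "\<phi> = cls P Q f" "\<gamma> = cls Q R g" "\<chi> = cls R S h" using H by (auto simp: Hom_rel_cat)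
  moreover have "f \<in> Hom C (fst P) (fst Q)" "g \<in> Hom C (fst Q) (fst R)" "h \<in> Hom C (fst R) (fst S)"
    using E by (simp_all add: equivar_iff)
  ultimately show "Cmp (rel_cat C U \<O>) P Q S (Cmp (rel_cat C U \<O>) Q R S \<chi> \<gamma>) \<phi>
      = Cmp (rel_cat C U \<O>) P R S \<chi> (Cmp (rel_cat C U \<O>) P Q R \<gamma> \<phi>)"
    using PQRS per_obsD(1) by (simp add: Cmp_rel_cat Cmp_equivar source.Cmp_assoc)
qed

end


section \<open>Initial morphisms, separated and injective objects\<close>

context concrete_category
begin

lemma initial_morD:
  assumes "initial_mor C U X Y f"
  shows "X \<in> Ob C" "Y \<in> Ob C" "f \<in> Hom C X Y"
  using assms by (auto simp: initial_mor_def initial_source_def)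

text \<open>
  Initiality lifts any map whose composite with \<open>|m|\<close> is a morphism. Since such a map can be chosen
  pointwise, all that matters is that \<open>|k|\<close> takes its values in the image of \<open>|m|\<close>.
\<close>

lemma initial_mor_factor:
  assumes m: "initial_mor C U X Y m" and Z: "Z \<in> Ob C" and k: "k \<in> Hom C Z Y"
    and image: "onMor U Z Y k ` onOb U Z \<subseteq> onMor U X Y m ` onOb U X"
  obtains h where "h \<in> Hom C Z X" "Cmp C Z X Y m h = k"
proof -
  note X = initial_morD[OF m]
  define h where "h = restrict (\<lambda>z. inv_into (onOb U X) (onMor U X Y m) (onMor U Z Y k z)) (onOb U Z)"
  have h: "h z \<in> onOb U X" "onMor U X Y m (h z) = onMor U Z Y k z" if "z \<in> onOb U Z" for z
    using image that by (auto simp: h_def intro!: inv_into_into f_inv_into_f)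
  have "h \<in> onOb U Z \<rightarrow>\<^sub>E onOb U X" using h by (auto simp: h_def)
  moreover have "compose (onOb U Z) (onMor U X Y m) h = onMor U Z Y k"
    using onMor_PiE[OF Z X(2) k] h by (auto simp: compose_def fun_eq_iff PiE_def extensional_def)
  ultimately obtain h' where h': "h' \<in> Hom C Z X" "onMor U Z X h' = h"
    using m Z k unfolding initial_mor_def initial_source_def by fastforce
  then have "Cmp C Z X Y m h' = k"
    using h by (intro mor_eqI[OF Z X(2)]) (simp_all add: Z X k source.Cmp_Hom onMor_Cmp_apply)
  with h' show ?thesis by (intro that)
qed

text \<open>
  The subset \<open>A\<close> becomes an object by lifting the source that consists of the single map
  \<open>A \<hookrightarrow> |Z|\<close>.
\<close>

lemma initial_inclusion:
  assumes \<U>: "set_universe \<U>" and top: "topological \<U> C U" and Z: "Z \<in> Ob C" and A: "A \<subseteq> onOb U Z"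
  obtains X m where "initial_mor C U X Z m" "onOb U X = A" "\<And>x. x \<in> A \<Longrightarrow> onMor U X Z m x = x"
proof -
  let ?i = "restrict id A"
  have "onOb U Z \<in> \<U>" using onOb_Ob[OF Z] by (simp add: Set_cat_def)
  then have "A \<in> \<U>" using \<U> A unfolding set_universe_def by blast
  moreover have "structured_source C U A {(Z, ?i)}"
    using Z A by (auto simp: structured_source_def)
  ultimately obtain X T where lift: "initial_lifting C U A {(Z, ?i)} X T"
    using top unfolding topological_def by blast
  then have init: "initial_source C U X T" and X: "onOb U X = A"
    and T: "(\<lambda>(Y, f). (Y, onMor U X Y f)) ` T = {(Z, ?i)}"
    by (auto simp: initial_lifting_def)
  have "(Z, ?i) \<in> (\<lambda>(Y, f). (Y, onMor U X Y f)) ` T" unfolding T by simp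
  then obtain m where m: "(Z, m) \<in> T" "onMor U X Z m = ?i" by auto
  \<comment> \<open>By faithfulness, distinct members of the lifted source would lie over distinct maps.\<close>
  have "T = {(Z, m)}"
  proof -
    have "q = (Z, m)" if q: "q \<in> T" for q
    proof -
      obtain Y f where [simp]: "q = (Y, f)" by (cases q)
      have f: "(Y, f) \<in> T" using q by simp
      then have "(Y, onMor U X Y f) \<in> (\<lambda>(Y, f). (Y, onMor U X Y f)) ` T" by force
      then have "Y = Z" "onMor U X Y f = ?i" using T by auto
      moreover have "X \<in> Ob C" "f \<in> Hom C X Y" "m \<in> Hom C X Z"
        using init f m(1) by (auto simp: initial_source_def)
      ultimately show ?thesis using m(2) Z mor_eqI[of X Z f m] by auto
    qed
    then show ?thesis using m(1) by blast
  qed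
  with init have "initial_mor C U X Z m" by (simp add: initial_mor_def)
  with X m(2) show ?thesis by (intro that) auto
qed

text \<open>
  Composition with \<open>m\<close> is monotone, so it turns \<open>f \<simeq> g\<close> into \<open>m \<cdot> f = m \<cdot> g\<close>, and \<open>m\<close> can be cancelled.
\<close>

lemma separated_if_inj_into_separated:
  assumes pre: "preorder_enriched C le" and Z: "separated C le Z" and X: "X \<in> Ob C"
    and m: "m \<in> Hom C X Z" and inj: "inj_on (onMor U X Z m) (onOb U X)"
  shows "separated C le X"
proof -
  have ZO: "Z \<in> Ob C" using Z by (simp add: separated_def)
  have "f = g" if Y: "Y \<in> Ob C" and f: "f \<in> Hom C Y X" and g: "g \<in> Hom C Y X"
    and fg: "simeq le Y X f g" for Y f g
  proof -
    have "le X Z m m"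
      using pre X ZO m by (auto simp: preorder_enriched_def dest: reflp_onD)
    then have "simeq le Y Z (Cmp C Y X Z m f) (Cmp C Y X Z m g)"
      using pre fg Y X ZO f g m unfolding preorder_enriched_def simeq_def by blast
    then have "Cmp C Y X Z m f = Cmp C Y X Z m g"
      using Z Y X ZO f g m source.Cmp_Hom unfolding separated_def by blast
    then have "onMor U X Z m (onMor U Y X f y) = onMor U X Z m (onMor U Y X g y)"
      if "y \<in> onOb U Y" for y
      using that Y X ZO f g m by (metis onMor_Cmp_apply)
    then show "f = g"
      using inj_onD[OF inj] onMor_mem[OF Y X f] onMor_mem[OF Y X g]
      by (intro mor_eqI[OF Y X f g]) blast
  qed
  then show ?thesis using X by (simp add: separated_def)
qed

text \<open>
  Injectivity yields an extension up to \<open>\<simeq>\<close>, which is an equality in a separated object.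
\<close>

lemma extension_along_initial:
  assumes "injective C U le Z" "separated C le Z" "initial_mor C U X Y y" "f \<in> Hom C X Z"
  obtains f' where "f' \<in> Hom C Y Z" "Cmp C X Y Z f' y = f"
proof -
  note X = initial_morD[OF assms(3)]
  obtain f' where f': "f' \<in> Hom C Y Z" "simeq le X Z (Cmp C X Y Z f' y) f"
    using assms X unfolding injective_def by blast
  moreover have "Cmp C X Y Z f' y \<in> Hom C X Z"
    using f' assms(2) X by (auto simp: separated_def source.Cmp_Hom)
  ultimately have "Cmp C X Y Z f' y = f"
    using assms(2,4) X unfolding separated_def by blast
  with f' show ?thesis by (intro that)
qed

text \<open>
  The adjunction identifies the elements of \<open>|X|\<close> with the morphisms \<open>L{*} \<rightarrow> X\<close>, and \<open>|f|\<close> with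
  composition by \<open>f\<close>. Elements with equal images thus correspond to points \<open>x\<close>, \<open>x'\<close> with
  \<open>f \<cdot> x = f \<cdot> x'\<close>, so \<open>x \<simeq> x'\<close> by hypothesis, and \<open>x = x'\<close> because \<open>X\<close> is separated.
\<close>

lemma initial_from_separated_inj:
  assumes \<U>: "set_universe \<U>" and adj: "left_adjoint (Set_cat \<U>) C L U"
    and pre: "preorder_enriched C le"
    and reflect: "\<And>x x'. \<lbrakk>x \<in> Hom C (onOb L {star}) X; x' \<in> Hom C (onOb L {star}) X;
        simeq le (onOb L {star}) Y (Cmp C (onOb L {star}) X Y f x) (Cmp C (onOb L {star}) X Y f x')\<rbrakk>
      \<Longrightarrow> simeq le (onOb L {star}) X x x'"
    and X: "separated C le X" and f: "initial_mor C U X Y f"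
  shows "inj_on (onMor U X Y f) (onOb U X)"
proof (rule inj_onI)
  fix a b assume ab: "a \<in> onOb U X" "b \<in> onOb U X" and eq: "onMor U X Y f a = onMor U X Y f b"
  let ?I = "onOb L {star}"
  note XY = initial_morD[OF f]
  have star: "{star} \<in> Ob (Set_cat \<U>)" using \<U> by (simp add: set_universe_def Set_cat_def)
  have "is_functor (Set_cat \<U>) C L" using adj by (simp add: left_adjoint_def)
  then have I: "?I \<in> Ob C" using star by (rule is_functor.onOb_Ob)
  obtain \<phi> where
    bij: "\<forall>A\<in>Ob (Set_cat \<U>). \<forall>X\<in>Ob C.
      bij_betw (\<phi> A X) (Hom C (onOb L A) X) (Hom (Set_cat \<U>) A (onOb U X))"
    and nat: "\<forall>A\<in>Ob (Set_cat \<U>). \<forall>X\<in>Ob C. \<forall>Y\<in>Ob C. \<forall>f\<in>Hom C (onOb L A) X. \<forall>g\<in>Hom C X Y.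
      \<phi> A Y (Cmp C (onOb L A) X Y g f)
      = Cmp (Set_cat \<U>) A (onOb U X) (onOb U Y) (onMor U X Y g) (\<phi> A X f)"
    using adj unfolding left_adjoint_def by metis
  have point: "\<exists>x\<in>Hom C ?I X. \<phi> {star} X x = (\<lambda>_\<in>{star}. c)" if "c \<in> onOb U X" for c
  proof -
    have "(\<lambda>_\<in>{star}. c) \<in> Hom (Set_cat \<U>) {star} (onOb U X)" using that by (auto simp: Set_cat_def)
    then have "(\<lambda>_\<in>{star}. c) \<in> \<phi> {star} X ` Hom C ?I X"
      unfolding bij_betw_imp_surj_on[OF bij[rule_format, OF star XY(1)]] .
    then obtain x where "x \<in> Hom C ?I X" "(\<lambda>_\<in>{star}. c) = \<phi> {star} X x" by (rule imageE)
    then show ?thesis by (intro bexI[of _ x]) simp_all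
  qed
  obtain x x' where x: "x \<in> Hom C ?I X" "\<phi> {star} X x = (\<lambda>_\<in>{star}. a)"
    and x': "x' \<in> Hom C ?I X" "\<phi> {star} X x' = (\<lambda>_\<in>{star}. b)"
    using point ab by metis
  have "\<phi> {star} Y (Cmp C ?I X Y f x) = \<phi> {star} Y (Cmp C ?I X Y f x')"
    using nat[rule_format, OF star XY(1,2) _ XY(3)] x x' eq
    by (simp add: Set_cat_def compose_def fun_eq_iff)
  then have "Cmp C ?I X Y f x = Cmp C ?I X Y f x'"
    using bij_betw_imp_inj_on[OF bij[rule_format, OF star XY(2)]] source.Cmp_Hom[OF I XY(1,2) _ XY(3)] x x'
    by (auto dest: inj_onD)
  moreover have "Cmp C ?I X Y f x' \<in> Hom C ?I Y" using source.Cmp_Hom[OF I XY(1,2) _ XY(3)] x' by blast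
  ultimately have "simeq le ?I Y (Cmp C ?I X Y f x) (Cmp C ?I X Y f x')"
    using pre I XY by (auto simp: preorder_enriched_def simeq_def dest: reflp_onD)
  then have "x = x'"
    using reflect x x' X I unfolding separated_def by blast
  then show "a = b" using x x' by (metis restrict_apply' singletonI)
qed

end


section \<open>Transporting equivalence relations along injective embeddings\<close>

text \<open>
  For a map that is not injective, transitivity of the image could fail: two unrelated elements
  might be identified.
\<close>

lemma partial_equiv_image:
  assumes "partial_equiv A r" "inj_on f A" "f ` A \<subseteq> B"
  shows "partial_equiv B (map_prod f f ` r)"
proof -
  have r: "r \<subseteq> A \<times> A" "sym r" "trans r" using assms by (auto simp: partial_equiv_def)
  have "sym (map_prod f f ` r)" using r(2) by (force simp: sym_def)
  moreover have "trans (map_prod f f ` r)"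
  proof (rule transI)
    fix x y z assume "(x, y) \<in> map_prod f f ` r" "(y, z) \<in> map_prod f f ` r"
    then obtain a b b' c where "(a, b) \<in> r" "(b', c) \<in> r" "x = f a" "y = f b" "y = f b'" "z = f c"
      by auto
    moreover have "b = b'" using calculation r(1) assms(2) by (auto dest: inj_onD)
    ultimately show "(x, z) \<in> map_prod f f ` r" using r(3) by (force dest: transD)
  qed
  ultimately show ?thesis using r(1) assms(3) by (auto simp: partial_equiv_def)
qed

text \<open>
  A choice of injective embeddings. That \<open>|emb X|\<close> is injective is what the hypothesis on points
  contributes, and it keeps the relation of an object recoverable from its image in the hull.
\<close>

locale separated_injective_hulls = concrete_category C \<U> U
  for C :: "('o, 'm) cat" and \<U> :: "'a set set" and U :: "('o, 'm, 'a set, 'a \<Rightarrow> 'a) funct" +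
  fixes le :: "'o \<Rightarrow> 'o \<Rightarrow> 'm \<Rightarrow> 'm \<Rightarrow> bool" and hull :: "'o \<Rightarrow> 'o" and emb :: "'o \<Rightarrow> 'm"
  assumes hull: "separated C le X \<Longrightarrow> separated C le (hull X)"
      "separated C le X \<Longrightarrow> injective C U le (hull X)"
    and emb: "separated C le X \<Longrightarrow> initial_mor C U X (hull X) (emb X)"
      "separated C le X \<Longrightarrow> inj_on (onMor U X (hull X) (emb X)) (onOb U X)"
begin

definition equ_obs :: "('o \<times> ('a \<times> 'a) set) set" where
  "equ_obs = {(X, r). separated C le X \<and> equiv (onOb U X) r}"

definition pequ_obs :: "('o \<times> ('a \<times> 'a) set) set" where
  "pequ_obs = {(X, r). separated C le X \<and> injective C U le X \<and> partial_equiv (onOb U X) r}"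

abbreviation embed :: "'o \<Rightarrow> 'a \<Rightarrow> 'a" where
  "embed X \<equiv> onMor U X (hull X) (emb X)"

definition hull_ob :: "'o \<times> ('a \<times> 'a) set \<Rightarrow> 'o \<times> ('a \<times> 'a) set" where
  "hull_ob P = (hull (fst P), map_prod (embed (fst P)) (embed (fst P)) ` snd P)"

definition extends where
  "extends P Q f g \<longleftrightarrow> f \<in> Hom C (fst P) (fst Q) \<and> g \<in> Hom C (hull (fst P)) (hull (fst Q)) \<and>
    Cmp C (fst P) (hull (fst P)) (hull (fst Q)) g (emb (fst P))
    = Cmp C (fst P) (fst Q) (hull (fst Q)) (emb (fst Q)) f"

text \<open>
  A class of morphisms is sent to the union of the classes of all extensions of all its
  representatives. These classes coincide, so that no extension has to be chosen.
\<close>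

definition hull_functor ::
  "('o \<times> ('a \<times> 'a) set, 'm set, 'o \<times> ('a \<times> 'a) set, 'm set) funct" where
  "hull_functor = \<lparr>onOb = hull_ob,
     onMor = (\<lambda>P Q \<phi>. \<Union>f\<in>\<phi>. \<Union>g\<in>Collect (extends P Q f). cls (hull_ob P) (hull_ob Q) g)\<rparr>"

lemma equ_obsD:
  assumes "P \<in> equ_obs"
  shows "separated C le (fst P)" "x \<in> onOb U (fst P) \<Longrightarrow> (x, x) \<in> snd P"
    "initial_mor C U (fst P) (hull (fst P)) (emb (fst P))"
    "inj_on (embed (fst P)) (onOb U (fst P))"
    "fst P \<in> Ob C" "hull (fst P) \<in> Ob C" "emb (fst P) \<in> Hom C (fst P) (hull (fst P))"
  using assms emb[of "fst P"] initial_morD[of "fst P" "hull (fst P)" "emb (fst P)"]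
  by (auto simp: equ_obs_def equiv_def refl_on_def)

lemma equ_obs_subset: "equ_obs \<subseteq> per_obs"
  by (auto simp: equ_obs_def per_obs_def separated_def partial_equiv_def equiv_def)

lemma pequ_obs_subset: "pequ_obs \<subseteq> per_obs"
  by (auto simp: pequ_obs_def per_obs_def separated_def)

lemma fst_hull_ob [simp]: "fst (hull_ob P) = hull (fst P)"
  by (simp add: hull_ob_def)

lemma hull_ob_rel:
  "(a, b) \<in> snd (hull_ob P) \<longleftrightarrow>
    (\<exists>x x'. (x, x') \<in> snd P \<and> a = embed (fst P) x \<and> b = embed (fst P) x')"
  by (force simp: hull_ob_def)

lemma embed_rel_iff:
  assumes "P \<in> equ_obs" "x \<in> onOb U (fst P)" "x' \<in> onOb U (fst P)"
  shows "(embed (fst P) x, embed (fst P) x') \<in> snd (hull_ob P) \<longleftrightarrow> (x, x') \<in> snd P"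
proof
  assume "(embed (fst P) x, embed (fst P) x') \<in> snd (hull_ob P)"
  then obtain y y' where y: "(y, y') \<in> snd P" "embed (fst P) x = embed (fst P) y"
    "embed (fst P) x' = embed (fst P) y'" by (auto simp: hull_ob_rel)
  have "P \<in> per_obs" using assms(1) equ_obs_subset by blast
  then have "y \<in> onOb U (fst P)" "y' \<in> onOb U (fst P)" using y(1) per_obsD(4,5) by blast+
  then have "x = y" "x' = y'" using inj_onD[OF equ_obsD(4)[OF assms(1)]] y(2,3) assms(2,3) by blast+
  with y(1) show "(x, x') \<in> snd P" by simp
next
  assume "(x, x') \<in> snd P"
  then show "(embed (fst P) x, embed (fst P) x') \<in> snd (hull_ob P)" unfolding hull_ob_rel by blast
qed

text \<open>
  The self-related elements of \<open>hull_ob P\<close> are images of elements of \<open>P\<close>. Conditions on the related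
  elements of \<open>hull_ob P\<close>, such as equivariance, are therefore conditions on \<open>P\<close>.
\<close>

lemma hull_ob_all_iff:
  "(\<forall>u v. (u, v) \<in> snd (hull_ob P) \<longrightarrow> R u v)
    \<longleftrightarrow> (\<forall>x x'. (x, x') \<in> snd P \<longrightarrow> R (embed (fst P) x) (embed (fst P) x'))"
  unfolding hull_ob_rel by blast

lemma hull_ob_all_diag_iff:
  assumes "P \<in> equ_obs"
  shows "(\<forall>u. (u, u) \<in> snd (hull_ob P) \<longrightarrow> R u)
    \<longleftrightarrow> (\<forall>x. (x, x) \<in> snd P \<longrightarrow> R (embed (fst P) x))"
proof -
  have "(x, x) \<in> snd P" if "(x, x') \<in> snd P" for x x'
    using assms per_refl(1)[OF _ that] equ_obs_subset by blast
  then show ?thesis unfolding hull_ob_rel by metis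
qed

lemma hull_ob_pequ:
  assumes "P \<in> equ_obs"
  shows "hull_ob P \<in> pequ_obs"
proof -
  have "partial_equiv (onOb U (fst P)) (snd P)"
    using assms equ_obs_subset by (auto simp: per_obs_def)
  then have "partial_equiv (onOb U (hull (fst P))) (snd (hull_ob P))"
    unfolding hull_ob_def snd_conv
    using equ_obsD[OF assms] onMor_mem by (intro partial_equiv_image) auto
  then show ?thesis
    using hull equ_obsD(1)[OF assms] by (simp add: pequ_obs_def hull_ob_def)
qed

lemma extends_apply:
  assumes "P \<in> equ_obs" "Q \<in> equ_obs" "extends P Q f g" "x \<in> onOb U (fst P)"
  shows "onMor U (hull (fst P)) (hull (fst Q)) g (embed (fst P) x)
    = embed (fst Q) (onMor U (fst P) (fst Q) f x)"
  using assms(3,4) equ_obsD[OF assms(1)] equ_obsD[OF assms(2)]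
  unfolding extends_def by (metis onMor_Cmp_apply)

text \<open>
  The images of \<open>|g|\<close> and \<open>|g'|\<close> at embedded points are themselves embedded points, and the embedding
  preserves and reflects the relation of \<open>Q\<close>.
\<close>

lemma extends_rel_iff:
  assumes P: "P \<in> equ_obs" and Q: "Q \<in> equ_obs" and ext: "extends P Q f g" "extends P Q f' g'"
    and x: "x \<in> onOb U (fst P)" "x' \<in> onOb U (fst P)"
  shows "(onMor U (hull (fst P)) (hull (fst Q)) g (embed (fst P) x),
      onMor U (hull (fst P)) (hull (fst Q)) g' (embed (fst P) x')) \<in> snd (hull_ob Q)
    \<longleftrightarrow> (onMor U (fst P) (fst Q) f x, onMor U (fst P) (fst Q) f' x') \<in> snd Q"
proof -
  have "f \<in> Hom C (fst P) (fst Q)" "f' \<in> Hom C (fst P) (fst Q)" using ext by (simp_all add: extends_def)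
  then have "onMor U (fst P) (fst Q) f x \<in> onOb U (fst Q)"
    "onMor U (fst P) (fst Q) f' x' \<in> onOb U (fst Q)"
    using x equ_obsD(5) P Q onMor_mem by blast+
  then show ?thesis
    using embed_rel_iff[OF Q] extends_apply[OF P Q] ext x by simp
qed

lemma extends_equivar_iff:
  assumes P: "P \<in> equ_obs" and Q: "Q \<in> equ_obs" and ext: "extends P Q f g"
  shows "g \<in> equivar (hull_ob P) (hull_ob Q) \<longleftrightarrow> f \<in> equivar P Q"
proof -
  have "P \<in> per_obs" using P equ_obs_subset by blast
  then have "(onMor U (hull (fst P)) (hull (fst Q)) g (embed (fst P) x),
      onMor U (hull (fst P)) (hull (fst Q)) g (embed (fst P) x')) \<in> snd (hull_ob Q)
    \<longleftrightarrow> (onMor U (fst P) (fst Q) f x, onMor U (fst P) (fst Q) f x') \<in> snd Q"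
    if "(x, x') \<in> snd P" for x x'
    using extends_rel_iff[OF P Q ext ext] per_obsD(4,5) that by blast
  moreover have "f \<in> Hom C (fst P) (fst Q)" "g \<in> Hom C (hull (fst P)) (hull (fst Q))"
    using ext by (auto simp: extends_def)
  ultimately show ?thesis by (simp add: equivar_iff hull_ob_all_iff cong: imp_cong)
qed

lemma extends_cls_eq_iff:
  assumes P: "P \<in> equ_obs" and Q: "Q \<in> equ_obs" and ext: "extends P Q f g" "extends P Q f' g'"
    and f: "f \<in> equivar P Q" "f' \<in> equivar P Q"
  shows "cls (hull_ob P) (hull_ob Q) g = cls (hull_ob P) (hull_ob Q) g' \<longleftrightarrow> cls P Q f = cls P Q f'"
proof -
  have obs: "P \<in> per_obs" "Q \<in> per_obs" "hull_ob P \<in> per_obs" "hull_ob Q \<in> per_obs"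
    using P Q equ_obs_subset pequ_obs_subset hull_ob_pequ by blast+
  have g: "g \<in> equivar (hull_ob P) (hull_ob Q)" "g' \<in> equivar (hull_ob P) (hull_ob Q)"
    using extends_equivar_iff P Q ext f by blast+
  show ?thesis
    unfolding cls_eq_iff[OF obs(3,4) g] cls_eq_iff[OF obs(1,2) f] hull_ob_all_diag_iff[OF P]
    using extends_rel_iff[OF P Q ext] per_obsD(4)[OF obs(1)] by (simp cong: imp_cong)
qed

text \<open>
  The two ways to complete a square rest on different properties of the embedding of \<open>fst Q\<close>:
  \<open>f\<close> extends because its codomain \<open>hull (fst Q)\<close> is injective, \<open>g\<close> restricts because the embedding
  is initial. The latter needs the relation of \<open>P\<close> to be reflexive: \<open>g\<close> sends each embedded point to
  a self-related one, and all self-related points of \<open>hull_ob Q\<close> come from \<open>Q\<close>.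
\<close>

lemma extends_exists:
  assumes P: "P \<in> equ_obs" and Q: "Q \<in> equ_obs" and f: "f \<in> equivar P Q"
  obtains g where "extends P Q f g"
proof -
  note P' = equ_obsD[OF P] and Q' = equ_obsD[OF Q]
  have f: "f \<in> Hom C (fst P) (fst Q)" using f by (simp add: equivar_iff)
  then have "Cmp C (fst P) (fst Q) (hull (fst Q)) (emb (fst Q)) f \<in> Hom C (fst P) (hull (fst Q))"
    using P' Q' by (simp add: source.Cmp_Hom)
  then obtain g where "g \<in> Hom C (hull (fst P)) (hull (fst Q))"
    "Cmp C (fst P) (hull (fst P)) (hull (fst Q)) g (emb (fst P))
      = Cmp C (fst P) (fst Q) (hull (fst Q)) (emb (fst Q)) f"
    using extension_along_initial[OF hull(2,1) P'(3)] Q'(1) by blast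
  with f show ?thesis by (intro that) (simp add: extends_def)
qed

lemma restricts_exists:
  assumes P: "P \<in> equ_obs" and Q: "Q \<in> equ_obs" and g: "g \<in> equivar (hull_ob P) (hull_ob Q)"
  obtains f where "extends P Q f g"
proof -
  note P' = equ_obsD[OF P] and Q' = equ_obsD[OF Q]
  let ?k = "Cmp C (fst P) (hull (fst P)) (hull (fst Q)) g (emb (fst P))"
  have gH: "g \<in> Hom C (hull (fst P)) (hull (fst Q))" using g by (simp add: equivar_iff)
  then have k: "?k \<in> Hom C (fst P) (hull (fst Q))" using P' Q' by (simp add: source.Cmp_Hom)
  have "onMor U (fst P) (hull (fst Q)) ?k x \<in> embed (fst Q) ` onOb U (fst Q)"
    if x: "x \<in> onOb U (fst P)" for x
  proof -
    have "(embed (fst P) x, embed (fst P) x) \<in> snd (hull_ob P)"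
      using P'(2)[OF x] by (auto simp: hull_ob_rel)
    then have "(onMor U (fst P) (hull (fst Q)) ?k x, onMor U (fst P) (hull (fst Q)) ?k x) \<in> snd (hull_ob Q)"
      using g P' Q' gH x by (simp add: equivar_iff onMor_Cmp_apply)
    moreover have "Q \<in> per_obs" using Q equ_obs_subset by blast
    ultimately show ?thesis using per_obsD(4) unfolding hull_ob_rel by blast
  qed
  then obtain f where "f \<in> Hom C (fst P) (fst Q)"
    "Cmp C (fst P) (fst Q) (hull (fst Q)) (emb (fst Q)) f = ?k"
    using initial_mor_factor[OF Q'(3) P'(5) k] by blast
  with gH show ?thesis by (intro that[of f]) (simp add: extends_def)
qed

lemma extends_Idn:
  assumes "P \<in> equ_obs"
  shows "extends P P (Idn C (fst P)) (Idn C (hull (fst P)))"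
  using equ_obsD[OF assms]
  by (simp add: extends_def source.Idn_Hom source.Cmp_Idn_left source.Cmp_Idn_right)

lemma extends_Cmp:
  assumes P: "P \<in> equ_obs" and Q: "Q \<in> equ_obs" and R: "R \<in> equ_obs"
    and ext: "extends P Q f g" "extends Q R f' g'"
  shows "extends P R (Cmp C (fst P) (fst Q) (fst R) f' f)
    (Cmp C (hull (fst P)) (hull (fst Q)) (hull (fst R)) g' g)"
proof -
  note [simp] = equ_obsD(5-7)[OF P] equ_obsD(5-7)[OF Q] equ_obsD(5-7)[OF R] source.Cmp_Hom
  have H [simp]: "f \<in> Hom C (fst P) (fst Q)" "g \<in> Hom C (hull (fst P)) (hull (fst Q))"
    "f' \<in> Hom C (fst Q) (fst R)" "g' \<in> Hom C (hull (fst Q)) (hull (fst R))"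
    and eq: "Cmp C (fst P) (hull (fst P)) (hull (fst Q)) g (emb (fst P))
      = Cmp C (fst P) (fst Q) (hull (fst Q)) (emb (fst Q)) f"
    and eq': "Cmp C (fst Q) (hull (fst Q)) (hull (fst R)) g' (emb (fst Q))
      = Cmp C (fst Q) (fst R) (hull (fst R)) (emb (fst R)) f'"
    using ext by (auto simp: extends_def)
  have "Cmp C (fst P) (hull (fst Q)) (hull (fst R)) g' (Cmp C (fst P) (fst Q) (hull (fst Q)) (emb (fst Q)) f)
      = Cmp C (fst P) (fst Q) (hull (fst R)) (Cmp C (fst Q) (hull (fst Q)) (hull (fst R)) g' (emb (fst Q))) f"
    by (rule source.Cmp_assoc[symmetric]) simp_all
  then show ?thesis by (simp add: extends_def source.Cmp_assoc eq eq')
qed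

text \<open>Any extension of any representative computes the functor.\<close>

lemma hull_functor_cls:
  assumes P: "P \<in> equ_obs" and Q: "Q \<in> equ_obs" and ext: "extends P Q f g" and f: "f \<in> equivar P Q"
  shows "onMor hull_functor P Q (cls P Q f) = cls (hull_ob P) (hull_ob Q) g"
proof -
  have PQ: "P \<in> per_obs" "Q \<in> per_obs" using P Q equ_obs_subset by blast+
  have "cls (hull_ob P) (hull_ob Q) g' = cls (hull_ob P) (hull_ob Q) g"
    if "f' \<in> cls P Q f" "extends P Q f' g'" for f' g'
  proof -
    have "f' \<in> equivar P Q" using that by (simp add: mor_equiv_iff)
    moreover have "cls P Q f' = cls P Q f"
      using that equiv_class_eq[OF equiv_mor_equiv[OF PQ]] by blast
    ultimately show ?thesis using extends_cls_eq_iff[OF P Q that(2) ext] f by blast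
  qed
  moreover have "f \<in> cls P Q f" using equiv_class_self[OF equiv_mor_equiv[OF PQ] f] .
  ultimately have "(\<Union>f'\<in>cls P Q f. \<Union>g'\<in>Collect (extends P Q f'). cls (hull_ob P) (hull_ob Q) g')
      = cls (hull_ob P) (hull_ob Q) g"
    using ext by blast
  then show ?thesis by (simp add: hull_functor_def)
qed

lemma hull_functor: "is_functor (rel_cat C U equ_obs) (rel_cat C U pequ_obs) hull_functor"
proof -
  interpret E: category "rel_cat C U equ_obs" by (rule category_rel_cat[OF equ_obs_subset])
  interpret P: category "rel_cat C U pequ_obs" by (rule category_rel_cat[OF pequ_obs_subset])
  have onOb [simp]: "onOb hull_functor = hull_ob" by (simp add: hull_functor_def)
  have per: "P \<in> per_obs" "hull_ob P \<in> per_obs" if "P \<in> equ_obs" for P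
    using that hull_ob_pequ equ_obs_subset pequ_obs_subset by blast+
  show ?thesis
  proof
    fix P assume "P \<in> Ob (rel_cat C U equ_obs)"
    then have P: "P \<in> equ_obs" by (simp add: Ob_rel_cat)
    then show "onOb hull_functor P \<in> Ob (rel_cat C U pequ_obs)"
      by (simp add: Ob_rel_cat hull_ob_pequ)
    show "onMor hull_functor P P (Idn (rel_cat C U equ_obs) P)
        = Idn (rel_cat C U pequ_obs) (onOb hull_functor P)"
      using hull_functor_cls[OF P P extends_Idn[OF P] Idn_equivar] P per by (simp add: Idn_rel_cat)
  next
    fix P Q \<phi>
    assume "P \<in> Ob (rel_cat C U equ_obs)" "Q \<in> Ob (rel_cat C U equ_obs)"
      and \<phi>: "\<phi> \<in> Hom (rel_cat C U equ_obs) P Q"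
    then have PQ: "P \<in> equ_obs" "Q \<in> equ_obs" by (simp_all add: Ob_rel_cat)
    from \<phi> obtain f where f: "f \<in> equivar P Q" "\<phi> = cls P Q f" by (auto simp: Hom_rel_cat)
    obtain g where "extends P Q f g" using extends_exists[OF PQ f(1)] .
    then show "onMor hull_functor P Q \<phi>
        \<in> Hom (rel_cat C U pequ_obs) (onOb hull_functor P) (onOb hull_functor Q)"
      using hull_functor_cls[OF PQ] extends_equivar_iff[OF PQ] f by (auto simp: Hom_rel_cat)
  next
    fix P Q R \<phi> \<psi>
    assume "P \<in> Ob (rel_cat C U equ_obs)" "Q \<in> Ob (rel_cat C U equ_obs)"
      "R \<in> Ob (rel_cat C U equ_obs)"
      and H: "\<phi> \<in> Hom (rel_cat C U equ_obs) P Q" "\<psi> \<in> Hom (rel_cat C U equ_obs) Q R"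
    then have P: "P \<in> equ_obs" and Q: "Q \<in> equ_obs" and R: "R \<in> equ_obs"
      by (simp_all add: Ob_rel_cat)
    from H obtain f f' where f: "f \<in> equivar P Q" "\<phi> = cls P Q f"
      and f': "f' \<in> equivar Q R" "\<psi> = cls Q R f'" by (auto simp: Hom_rel_cat)
    obtain g where g: "extends P Q f g" using extends_exists[OF P Q f(1)] .
    obtain g' where g': "extends Q R f' g'" using extends_exists[OF Q R f'(1)] .
    have ff: "Cmp C (fst P) (fst Q) (fst R) f' f \<in> equivar P R"
      using Cmp_equivar f f' per P Q R by blast
    have gg: "g \<in> equivar (hull_ob P) (hull_ob Q)" "g' \<in> equivar (hull_ob Q) (hull_ob R)"
      using extends_equivar_iff f f' g g' P Q R by blast+
    show "onMor hull_functor P R (Cmp (rel_cat C U equ_obs) P Q R \<psi> \<phi>)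
        = Cmp (rel_cat C U pequ_obs) (onOb hull_functor P) (onOb hull_functor Q)
            (onOb hull_functor R) (onMor hull_functor Q R \<psi>) (onMor hull_functor P Q \<phi>)"
      using hull_functor_cls[OF P Q g f(1)] hull_functor_cls[OF Q R g' f'(1)]
        hull_functor_cls[OF P R extends_Cmp[OF P Q R g g'] ff] per P Q R f f' gg
      by (simp add: Cmp_rel_cat)
  qed
qed

lemma hull_functor_fully_faithful:
  assumes P: "P \<in> equ_obs" and Q: "Q \<in> equ_obs"
  shows "bij_betw (onMor hull_functor P Q) (Hom (rel_cat C U equ_obs) P Q)
    (Hom (rel_cat C U pequ_obs) (hull_ob P) (hull_ob Q))"
proof (rule bij_betw_imageI)
  show "inj_on (onMor hull_functor P Q) (Hom (rel_cat C U equ_obs) P Q)"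
  proof (rule inj_onI)
    fix \<phi> \<psi> assume "\<phi> \<in> Hom (rel_cat C U equ_obs) P Q" "\<psi> \<in> Hom (rel_cat C U equ_obs) P Q"
      and eq: "onMor hull_functor P Q \<phi> = onMor hull_functor P Q \<psi>"
    then obtain f f' where f: "f \<in> equivar P Q" "\<phi> = cls P Q f"
      and f': "f' \<in> equivar P Q" "\<psi> = cls P Q f'" by (auto simp: Hom_rel_cat)
    obtain g where g: "extends P Q f g" using extends_exists[OF P Q f(1)] .
    obtain g' where g': "extends P Q f' g'" using extends_exists[OF P Q f'(1)] .
    show "\<phi> = \<psi>"
      using eq hull_functor_cls[OF P Q] extends_cls_eq_iff[OF P Q g g'] f f' g g' by simp
  qed
  show "onMor hull_functor P Q ` Hom (rel_cat C U equ_obs) P Q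
      = Hom (rel_cat C U pequ_obs) (hull_ob P) (hull_ob Q)"
  proof
    have "onMor hull_functor P Q \<phi> \<in> Hom (rel_cat C U pequ_obs) (hull_ob P) (hull_ob Q)"
      if "\<phi> \<in> Hom (rel_cat C U equ_obs) P Q" for \<phi>
      using is_functor.onMor_Hom[OF hull_functor _ _ that] P Q
      by (simp add: Ob_rel_cat hull_functor_def)
    then show "onMor hull_functor P Q ` Hom (rel_cat C U equ_obs) P Q
        \<subseteq> Hom (rel_cat C U pequ_obs) (hull_ob P) (hull_ob Q)" by blast
    show "Hom (rel_cat C U pequ_obs) (hull_ob P) (hull_ob Q)
        \<subseteq> onMor hull_functor P Q ` Hom (rel_cat C U equ_obs) P Q"
    proof
      fix \<gamma> assume "\<gamma> \<in> Hom (rel_cat C U pequ_obs) (hull_ob P) (hull_ob Q)"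
      then obtain g where g: "g \<in> equivar (hull_ob P) (hull_ob Q)" "\<gamma> = cls (hull_ob P) (hull_ob Q) g"
        by (auto simp: Hom_rel_cat)
      obtain f where f: "extends P Q f g" using restricts_exists[OF P Q g(1)] .
      then have E: "f \<in> equivar P Q" using extends_equivar_iff[OF P Q f] g(1) by blast
      then show "\<gamma> \<in> onMor hull_functor P Q ` Hom (rel_cat C U equ_obs) P Q"
        using hull_functor_cls[OF P Q f E] g(2) by (auto simp: Hom_rel_cat)
    qed
  qed
qed

text \<open>
  A partial equivalence relation on \<open>Z\<close> restricts to an equivalence relation on the subobject \<open>X\<close>
  carried by its domain. The objects \<open>hull X\<close> and \<open>Z\<close> extend each other's embeddings of \<open>X\<close>, and
  the extensions are inverse to each other on the elements of \<open>X\<close>.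
\<close>

lemma hull_functor_essentially_surjective:
  assumes \<U>: "set_universe \<U>" and top: "topological \<U> C U" and pre: "preorder_enriched C le"
    and W: "W \<in> pequ_obs"
  shows "\<exists>P\<in>equ_obs. \<exists>\<epsilon>. iso_mor (rel_cat C U pequ_obs) (hull_ob P) W \<epsilon>"
proof -
  obtain Z r where Zr: "W = (Z, r)" by (cases W)
  have Z: "separated C le Z" "injective C U le Z" "Z \<in> Ob C" and r: "partial_equiv (onOb U Z) r"
    using W by (auto simp: Zr pequ_obs_def separated_def)
  have Wper: "W \<in> per_obs" using W pequ_obs_subset by blast
  have "Domain r \<subseteq> onOb U Z" using r by (auto simp: partial_equiv_def)
  then obtain X m where m: "initial_mor C U X Z m" and X: "onOb U X = Domain r"
    and incl: "\<And>x. x \<in> Domain r \<Longrightarrow> onMor U X Z m x = x"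
    using initial_inclusion[OF \<U> top Z(3)] by metis
  have "inj_on (onMor U X Z m) (onOb U X)" by (rule inj_onI) (simp add: X incl)
  then have sep: "separated C le X"
    using separated_if_inj_into_separated[OF pre Z(1)] initial_morD[OF m] by blast
  have refl: "(x, x) \<in> r" if "x \<in> Domain r" for x
    using that r by (auto simp: partial_equiv_def dest: symD transD)
  have dom: "x \<in> Domain r \<and> x' \<in> Domain r" if "(x, x') \<in> r" for x x'
    using that r by (auto simp: partial_equiv_def dest: symD)
  have "equiv (onOb U X) r"
    using r dom refl unfolding X by (intro equivI) (auto simp: partial_equiv_def refl_on_def)
  define P where "P = (X, r)"
  have fstP: "fst P = X" by (simp add: P_def)
  have P: "P \<in> equ_obs" using sep \<open>equiv (onOb U X) r\<close> by (simp add: P_def equ_obs_def)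
  have hP: "hull_ob P \<in> pequ_obs" "hull_ob P \<in> per_obs"
    using hull_ob_pequ[OF P] pequ_obs_subset by blast+
  note P' = equ_obsD[OF P, unfolded P_def fst_conv]
  obtain a where a: "a \<in> Hom C (hull X) Z" "Cmp C X (hull X) Z a (emb X) = m"
    using extension_along_initial[OF Z(2,1) emb(1)[OF sep]] initial_morD(3)[OF m] by blast
  obtain b where b: "b \<in> Hom C Z (hull X)" "Cmp C X Z (hull X) b m = emb X"
    using extension_along_initial[OF hull(2)[OF sep] hull(1)[OF sep] m] P'(7) by blast
  have a_apply: "onMor U (hull X) Z a (embed X x) = x" if "x \<in> Domain r" for x
    using onMor_Cmp_apply[OF P'(5,6) Z(3) P'(7) a(1)] that X a(2) incl by metis
  have b_apply: "onMor U Z (hull X) b x = embed X x" if "x \<in> Domain r" for x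
    using onMor_Cmp_apply[OF P'(5) Z(3) P'(6) initial_morD(3)[OF m] b(1)] that X b(2) incl by metis
  have hull_rel: "(u, v) \<in> snd (hull_ob P) \<longleftrightarrow> (\<exists>x x'. (x, x') \<in> r \<and> u = embed X x \<and> v = embed X x')"
    for u v by (simp add: hull_ob_rel P_def)
  have aE: "a \<in> equivar (hull_ob P) W"
    using a(1) dom a_apply by (auto simp: equivar_iff hull_rel Zr fstP)
  have bE: "b \<in> equivar W (hull_ob P)"
    using b(1) dom b_apply by (auto simp: equivar_iff hull_rel Zr fstP)
  have mem: "embed X x \<in> onOb U (hull X)" if "x \<in> Domain r" for x
    using onMor_mem[OF P'(5-7)] that X by blast
  have "onMor U (hull X) (hull X) (Cmp C (hull X) Z (hull X) b a) u
      = onMor U (hull X) (hull X) (Idn C (hull X)) u" if u: "(u, u) \<in> snd (hull_ob P)" for u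
  proof -
    obtain x where x: "x \<in> Domain r" "u = embed X x" using u by (auto simp: hull_rel)
    show ?thesis
      unfolding x(2) onMor_Cmp_apply[OF P'(6) Z(3) P'(6) a(1) b(1) mem[OF x(1)]]
        onMor_Idn_apply[OF P'(6) mem[OF x(1)]]
      by (simp add: a_apply b_apply x(1))
  qed
  then have ba: "cls (hull_ob P) (hull_ob P) (Cmp C (hull X) Z (hull X) b a)
      = cls (hull_ob P) (hull_ob P) (Idn C (hull X))"
    using Cmp_equivar[OF hP(2) Wper hP(2) aE bE] Idn_equivar[OF hP(2)]
    by (intro cls_eqI[OF hP(2) hP(2)]) (simp_all add: fstP Zr)
  have "onMor U Z Z (Cmp C Z (hull X) Z a b) x = onMor U Z Z (Idn C Z) x" if x: "(x, x) \<in> r" for x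
  proof -
    have xZ: "x \<in> onOb U Z" using x r by (auto simp: partial_equiv_def)
    show ?thesis
      unfolding onMor_Cmp_apply[OF Z(3) P'(6) Z(3) b(1) a(1) xZ] onMor_Idn_apply[OF Z(3) xZ]
      using dom[OF x] by (simp add: a_apply b_apply)
  qed
  then have ab: "cls W W (Cmp C Z (hull X) Z a b) = cls W W (Idn C Z)"
    using Cmp_equivar[OF Wper hP(2) Wper bE aE] Idn_equivar[OF Wper]
    by (intro cls_eqI[OF Wper Wper]) (simp_all add: fstP Zr)
  have "iso_mor (rel_cat C U pequ_obs) (hull_ob P) W (cls (hull_ob P) W a)"
    unfolding iso_mor_def
  proof (intro conjI bexI)
    show "cls (hull_ob P) W a \<in> Hom (rel_cat C U pequ_obs) (hull_ob P) W"
      "cls W (hull_ob P) b \<in> Hom (rel_cat C U pequ_obs) W (hull_ob P)"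
      using aE bE by (auto simp: Hom_rel_cat)
    show "Cmp (rel_cat C U pequ_obs) (hull_ob P) W (hull_ob P) (cls W (hull_ob P) b) (cls (hull_ob P) W a)
        = Idn (rel_cat C U pequ_obs) (hull_ob P)"
      using ba Cmp_rel_cat[OF hP(2) Wper hP(2) aE bE] by (simp add: Idn_rel_cat fstP Zr)
    show "Cmp (rel_cat C U pequ_obs) W (hull_ob P) W (cls (hull_ob P) W a) (cls W (hull_ob P) b)
        = Idn (rel_cat C U pequ_obs) W"
      using ab Cmp_rel_cat[OF Wper hP(2) Wper bE aE] by (simp add: Idn_rel_cat fstP Zr)
  qed
  then show ?thesis using P by blast
qed

end


theorem theorem1p2:
  fixes \<U> :: "'a set set"
    and C :: "('o, 'm) cat"
    and U :: "('o, 'm, 'a set, 'a \<Rightarrow> 'a) funct"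
    and L :: "('a set, 'a \<Rightarrow> 'a, 'o, 'm) funct"
    and le :: "'o \<Rightarrow> 'o \<Rightarrow> 'm \<Rightarrow> 'm \<Rightarrow> bool"
    and star :: 'a
    and One :: 'o
  assumes "set_universe \<U>"
    and "category C"
    and "topological \<U> C U"
    and "left_adjoint (Set_cat \<U>) C L U"
    and "One = onOb L {star}"
    and "preorder_enriched C le"
    and "\<And>X Y x x' f. \<lbrakk>X \<in> Ob C; Y \<in> Ob C; x \<in> Hom C One X; x' \<in> Hom C One X; f \<in> Hom C X Y;
           initial_mor C U X Y f; simeq le One Y (Cmp C One X Y f x) (Cmp C One X Y f x')\<rbrakk>
         \<Longrightarrow> simeq le One X x x'"
    and "enough_injectives C U le"
  shows "equivalent_categories (Equ_sep C U le) (PEqu_sep C U le)"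
proof -
  interpret concrete_category C \<U> U
    using assms(3) by (auto simp: topological_def concrete_category_def concrete_category_axioms_def)
  have "\<forall>X\<in>Ob C. \<exists>X' y. initial_mor C U X X' y \<and> injective C U le X' \<and>
      (separated C le X \<longrightarrow> separated C le X')"
    using assms(8) unfolding enough_injectives_def by blast
  then obtain hull emb where he: "\<forall>X\<in>Ob C. initial_mor C U X (hull X) (emb X) \<and>
      injective C U le (hull X) \<and> (separated C le X \<longrightarrow> separated C le (hull X))"
    by metis
  interpret separated_injective_hulls C \<U> U le hull emb
  proof
    fix X assume X: "separated C le X"
    then have XO: "X \<in> Ob C" by (simp add: separated_def)
    show "separated C le (hull X)" "injective C U le (hull X)"
      and init: "initial_mor C U X (hull X) (emb X)"
      using he X XO by blast+
    show "inj_on (onMor U X (hull X) (emb X)) (onOb U X)"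
      using initial_from_separated_inj[OF assms(1,4,6) _ X init, of star]
        assms(7)[OF XO initial_morD(2)[OF init] _ _ initial_morD(3)[OF init] init]
      unfolding assms(5) by blast
  qed
  have "equivalent_categories (rel_cat C U equ_obs) (rel_cat C U pequ_obs)"
  proof (rule is_functor.equivalence_if_fully_faithful_essentially_surjective[OF hull_functor])
    show "bij_betw (onMor hull_functor P Q) (Hom (rel_cat C U equ_obs) P Q)
        (Hom (rel_cat C U pequ_obs) (onOb hull_functor P) (onOb hull_functor Q))"
      if "P \<in> Ob (rel_cat C U equ_obs)" "Q \<in> Ob (rel_cat C U equ_obs)" for P Q
      using hull_functor_fully_faithful that by (simp add: Ob_rel_cat hull_functor_def)
    show "\<exists>P\<in>Ob (rel_cat C U equ_obs). \<exists>\<epsilon>. iso_mor (rel_cat C U pequ_obs) (onOb hull_functor P) W \<epsilon>"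
      if "W \<in> Ob (rel_cat C U pequ_obs)" for W
      using hull_functor_essentially_surjective[OF assms(1,3,6)] that
      by (simp add: Ob_rel_cat hull_functor_def)
  qed
  then show ?thesis by (simp add: Equ_sep_def PEqu_sep_def equ_obs_def pequ_obs_def)
qed

end
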